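(* Let $X$ be a separable Banach space and let $f:X\to\mathbb{R}$ be quasiconvex and densely continuous. Set $m:=\mathcal{T}\operatorname{ess\,inf}_X f$. Then $f$ is Hadamard differentiable on $X\setminus F'_m$ except at the points of an Aronszajn null set.
   Context: Banach spaces are real. A function $f:X\to\mathbb{R}$ is quasiconvex if $f(\lambda x+(1-\lambda)y)\le\max\{f(x),f(y)\}$ for all $x,y\in X$ and $\lambda\in[0,1]$. It is densely continuous if it is continuous at the points of a dense subset of $X$. For $\alpha\in\mathbb{R}\cup\{-\infty\}$, $F_\alpha:=\{x\in X:f(x)<\alpha\}$ and $F'_\alpha:=\{x\in X:f(x)\le\alpha\}$ (both empty for $\alpha=-\infty$). First category means a countable union of nowhere dense subsets of $X$; second category means not of first category. The topological essential infimum is $\mathcal{T}\operatorname{ess\,inf}_X f:=\sup\{\alpha\in\mathbb{R}:F_\alpha\text{ is of first category}\}=\inf\{\alpha\in\mathbb{R}:F_\alpha\text{ is of second category}\}\in[-\infty,\infty)$. $f$ is Gâteaux differentiable at $x$ with derivative $Df(x)\in X^*$ if $Df(x)h=\lim_{t\to0}\frac{f(x+th)-f(x)}{t}$ for every $h\in X$; it is Hadamard differentiable at $x$ if moreover the limit is uniform for $h$ in every compact subset of $X$. A Borel set $E\subset X$ is Aronszajn null if for every sequence $(\xi_n)\subset X$ with $\overline{\operatorname{span}}\{\xi_n\}=X$ one can write $E=\bigcup_nE_n$ with $E_n$ Borel and, for every $x\in X$, $\lambda_1((x+\mathbb{R}\xi_n)\cap E_n)=0$ ($\lambda_1$ = one-dimensional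 Lebesgue measure). "A property holds on $S$ except at the points of an Aronszajn null set" means that there is an Aronszajn null set $N$ such that the property holds at every point of $S\setminus N$. *)

theory Defs
  imports "HOL-Analysis.Analysis"
begin

class separable_banach = banach +
  assumes separable_UNIV: "separable_space (topology open)"

text \<open>The subclass relation gives access to the library's facts about
  \<open>{banach, second_countable_topology}\<close>.\<close>

instance separable_banach \<subseteq> second_countable_topology
proof
  obtain D :: "'a set" where D: "countable D" "closure D = UNIV"
    using separable_UNIV unfolding separable_space_def by auto
  define B where "B = (\<lambda>(d, n). ball d (1 / real (Suc n))) ` (D \<times> (UNIV :: nat set))"
  have "countable B"
    unfolding B_def using D(1) by (intro countable_image countable_SIGMA) auto
  moreover have "topological_basis B"
  proof (rule topological_basisI)
    show "open B'" if "B' \<in> B" for B'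
      using that unfolding B_def by auto
  next
    fix U :: "'a set" and x
    assume "open U" "x \<in> U"
    then obtain e where e: "e > 0" "ball x e \<subseteq> U"
      by (meson open_contains_ball)
    obtain n where n: "1 / real (Suc n) < e / 2"
      using e(1) nat_approx_posE[of "e / 2"] by auto
    have "x \<in> closure D"
      using D(2) by simp
    then obtain d where d: "d \<in> D" "dist d x < 1 / real (Suc n)"
      by (meson closure_approachable of_nat_0_less_iff zero_less_Suc zero_less_divide_1_iff)
    have "ball d (1 / real (Suc n)) \<subseteq> ball x e"
    proof
      fix y assume "y \<in> ball d (1 / real (Suc n))"
      then have "dist d y < e / 2"
        using n by simp
      moreover have "dist d x < e / 2"
        using d n by linarith
      ultimately show "y \<in> ball x e"
        using dist_triangle_half_r[of d x e y] by simp
    qed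
    moreover have "ball d (1 / real (Suc n)) \<in> B"
      unfolding B_def using d(1) by force
    moreover have "x \<in> ball d (1 / real (Suc n))"
      using d(2) by simp
    ultimately show "\<exists>B'\<in>B. x \<in> B' \<and> B' \<subseteq> U"
      using e(2) by blast
  qed
  ultimately show "\<exists>B :: 'a set set. countable B \<and> open = generate_topology B"
    using topological_basis_imp_subbasis by blast
qed

definition quasiconvex :: "('a::real_vector \<Rightarrow> real) \<Rightarrow> bool" where
  "quasiconvex f \<longleftrightarrow>
    (\<forall>x y. \<forall>l\<in>{0..1}. f (l *\<^sub>R x + (1 - l) *\<^sub>R y) \<le> max (f x) (f y))"

definition densely_continuous :: "('a::t2_space \<Rightarrow> 'b::topological_space) \<Rightarrow> bool" where
  "densely_continuous f \<longleftrightarrow> (\<exists>D. closure D = UNIV \<and> (\<forall>x\<in>D. isCont f x))"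

definition nowhere_dense :: "'a::topological_space set \<Rightarrow> bool" where
  "nowhere_dense A \<longleftrightarrow> interior (closure A) = {}"

definition first_category :: "'a::topological_space set \<Rightarrow> bool" where
  "first_category S \<longleftrightarrow> (\<exists>A :: nat \<Rightarrow> 'a set. (\<forall>n. nowhere_dense (A n)) \<and> S = (\<Union>n. A n))"

definition second_category :: "'a::topological_space set \<Rightarrow> bool" where
  "second_category S \<longleftrightarrow> \<not> first_category S"

text \<open>The levels are extended reals, so that for the level \<open>-\<infinity>\<close> both sets are empty.\<close>

definition strict_sublevel :: "('a \<Rightarrow> real) \<Rightarrow> ereal \<Rightarrow> 'a set" where
  "strict_sublevel f \<alpha> = {x. ereal (f x) < \<alpha>}"

definition sublevel :: "('a \<Rightarrow> real) \<Rightarrow> ereal \<Rightarrow> 'a set" where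
  "sublevel f \<alpha> = {x. ereal (f x) \<le> \<alpha>}"

definition top_ess_inf :: "('a::topological_space \<Rightarrow> real) \<Rightarrow> ereal" where
  "top_ess_inf f = Sup {ereal \<alpha> | \<alpha> :: real. first_category (strict_sublevel f (ereal \<alpha>))}"

lemma first_category_subset:
  assumes "first_category S" "T \<subseteq> S"
  shows "first_category T"
proof -
  obtain A :: "nat \<Rightarrow> 'a set" where A: "\<And>n. nowhere_dense (A n)" "S = (\<Union>n. A n)"
    using assms(1) unfolding first_category_def by blast
  have "nowhere_dense (A n \<inter> T)" for n
    using A(1)[of n] interior_mono[OF closure_mono[of "A n \<inter> T" "A n"]]
    unfolding nowhere_dense_def by blast
  moreover have "T = (\<Union>n. A n \<inter> T)"
    using A(2) assms(2) by blast
  ultimately show ?thesis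
    unfolding first_category_def by (intro exI[of _ "\<lambda>n. A n \<inter> T"]) simp
qed

lemma top_ess_inf_eq_Inf:
  "top_ess_inf f = Inf {ereal \<alpha> | \<alpha> :: real. second_category (strict_sublevel f (ereal \<alpha>))}"
    (is "_ = Inf ?I")
proof (rule antisym)
  have "\<alpha> \<le> \<beta>" if "first_category (strict_sublevel f (ereal \<alpha>))"
    "second_category (strict_sublevel f (ereal \<beta>))" for \<alpha> \<beta> :: real
  proof (rule ccontr)
    assume "\<not> \<alpha> \<le> \<beta>"
    then have "strict_sublevel f (ereal \<beta>) \<subseteq> strict_sublevel f (ereal \<alpha>)"
      unfolding strict_sublevel_def by auto
    then show False
      using that first_category_subset unfolding second_category_def by blast
  qed
  then show "top_ess_inf f \<le> Inf ?I"
    unfolding top_ess_inf_def by (auto intro!: Sup_least Inf_greatest)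
next
  show "Inf ?I \<le> top_ess_inf f"
  proof (rule ccontr)
    assume "\<not> Inf ?I \<le> top_ess_inf f"
    then obtain r :: real where r: "top_ess_inf f < ereal r" "ereal r < Inf ?I"
      using ereal_dense2 by (meson not_le)
    show False
    proof (cases "first_category (strict_sublevel f (ereal r))")
      case True
      then have "ereal r \<le> top_ess_inf f"
        unfolding top_ess_inf_def by (intro Sup_upper) blast
      then show False
        using r(1) by simp
    next
      case False
      then have "Inf ?I \<le> ereal r"
        by (intro Inf_lower) (auto simp: second_category_def)
      then show False
        using r(2) by simp
    qed
  qed
qed

definition has_gateaux_derivative ::
    "('a::real_normed_vector \<Rightarrow> real) \<Rightarrow> ('a \<Rightarrow>\<^sub>L real) \<Rightarrow> 'a \<Rightarrow> bool" where
  "has_gateaux_derivative f L x \<longleftrightarrow>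
    (\<forall>h. ((\<lambda>t. (f (x + t *\<^sub>R h) - f x) / t) \<longlongrightarrow> blinfun_apply L h) (at 0))"

definition hadamard_differentiable :: "('a::real_normed_vector \<Rightarrow> real) \<Rightarrow> 'a \<Rightarrow> bool" where
  "hadamard_differentiable f x \<longleftrightarrow>
    (\<exists>L. has_gateaux_derivative f L x \<and>
      (\<forall>K. compact K \<longrightarrow>
        uniform_limit K (\<lambda>t h. (f (x + t *\<^sub>R h) - f x) / t) (blinfun_apply L) (at 0)))"

text \<open>The one-dimensional measure on the line \<open>x + \<real>v\<close> is expressed through the
  parametrization \<open>t \<mapsto> x + tv\<close>, which for \<open>v \<noteq> 0\<close> changes it only by the factor \<open>norm v\<close>.
  For \<open>v = 0\<close> the line degenerates to a single point, which has measure \<open>0\<close>.\<close>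

definition null_along :: "'a::real_normed_vector \<Rightarrow> 'a set \<Rightarrow> bool" where
  "null_along v E \<longleftrightarrow> (v \<noteq> 0 \<longrightarrow> (\<forall>x. {t :: real. x + t *\<^sub>R v \<in> E} \<in> null_sets lborel))"

definition aronszajn_null :: "'a::real_normed_vector set \<Rightarrow> bool" where
  "aronszajn_null E \<longleftrightarrow>
    E \<in> sets borel \<and>
    (\<forall>\<xi> :: nat \<Rightarrow> 'a. closure (span (range \<xi>)) = UNIV \<longrightarrow>
      (\<exists>A :: nat \<Rightarrow> 'a set.
        E = (\<Union>n. A n) \<and> (\<forall>n. A n \<in> sets borel \<and> null_along (\<xi> n) (A n))))"

end

theory Submission
  imports Defs
begin

text \<open>
  A quasiconvex function increases along rays that start in one of its strict sublevel sets: if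
  \<open>f w < q\<close> then \<open>max f q\<close> is nondecreasing along every ray issuing from \<open>w\<close>. Let \<open>q\<close> lie strictly
  above the topological essential infimum. As some lower sublevel set is of second category, dense continuity
  shows that \<open>{f < q}\<close> contains a ball, so \<open>max f q\<close> is monotone, near each point, along an open set of
  directions. This is local cone monotonicity, and the theorem becomes an instance of
  almost everywhere differentiability of cone-monotone functions.

  Monotonicity in an open cone of directions squeezes the increments of \<open>g = max f q\<close> at \<open>x\<close> in all
  directions between two increments along a single line. A monotone function of one variable is pointwise Lipschitz almost everywhere
  (\<open>monotone_pointwise_lipschitz_AE\<close>), hence \<open>max f q\<close> is pointwise Lipschitz outside an Aronszajn
  null set (\<open>ray_monotone_pointwise_lipschitz\<close>). A point \<open>x\<close> with \<open>f x > q\<close> outside the frontier of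
  \<open>{f < q}\<close> has a neighbourhood on which \<open>f\<close> and \<open>max f q\<close> agree. The frontier is Aronszajn null,
  because the distance to a convex body has a kink at each frontier point. Rational levels \<open>q\<close>
  suffice, so \<open>f\<close> is pointwise Lipschitz at all points of the asserted region outside one Aronszajn
  null set.

  It remains to pass from pointwise Lipschitz to Hadamard differentiable, which is Stepanov's theorem
  (\<open>hadamard_differentiable_if_pointwise_lipschitz\<close>). The pointwise Lipschitz points of an arbitrary
  function are covered by countably many sets \<open>A\<close> on which the function is Lipschitz. Let \<open>G\<close> be
  a Lipschitz extension of the restriction to \<open>A\<close>. At a point of \<open>A\<close> at which both \<open>G\<close> and the distance to \<open>A\<close>
  are Gateaux differentiable, the latter has derivative zero, so the function differs from \<open>G\<close> by
  \<open>o(t)\<close>. Thus everything rests on Rademacher's theorem for Lipschitz functions on separable spaces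
  (\<open>lipschitz_gateaux_differentiable\<close>). Existence of directional derivatives there is a
  one-dimensional statement. Additivity of the derivative in the direction is obtained by the
  same device: closed sets on which \<open>f (y + t k) - f y\<close> is uniformly close to \<open>t b\<close>, and
  differentiability of the distance to these sets.

  The link between lines and Aronszajn nullity is \<open>decomposable_along_if_line_null\<close>: a Borel set that
  is null on all lines parallel to one vector in the span of the sequence \<open>\<xi>\<close> splits into Borel sets
  null in the directions \<open>\<xi> n\<close>.
\<close>

section \<open>Monotone functions on the line\<close>

definition pointwise_lipschitz :: "('a::real_normed_vector \<Rightarrow> real) \<Rightarrow> 'a \<Rightarrow> bool" where
  "pointwise_lipschitz f x \<longleftrightarrow>
    (\<exists>C. \<exists>d>0. \<forall>h. norm h < d \<longrightarrow> \<bar>f (x + h) - f x\<bar> \<le> C * norm h)"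

text \<open>
  Difference quotients at \<open>t\<close> belong to intervals that have \<open>t\<close> as an endpoint. Vitali's theorem
  allows this, since it asks only that the covering balls contain the point.
\<close>

lemma Vitali_covering_intervals:
  fixes K :: "(real \<times> real) set"
  assumes K: "\<And>u w. (u, w) \<in> K \<Longrightarrow> u < w"
    and S: "\<And>x d. x \<in> S \<Longrightarrow> 0 < d \<Longrightarrow> \<exists>u w. (u, w) \<in> K \<and> x \<in> {u..w} \<and> w - u < d"
  obtains C where "countable C" "C \<subseteq> K"
    "disjoint_family_on (\<lambda>I. {fst I..snd I}) C"
    "negligible (S - (\<Union>I\<in>C. {fst I..snd I}))"
proof -
  define a where "a I = (fst I + snd I) / 2" for I :: "real \<times> real"
  define r where "r I = (snd I - fst I) / 2" for I :: "real \<times> real"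
  have cb: "cball (a I) (r I) = {fst I..snd I}" for I
    unfolding cball_eq_atLeastAtMost a_def r_def by (auto simp: field_simps)
  have "0 < r I" if "I \<in> K" for I
    using K[of "fst I" "snd I"] that by (simp add: r_def)
  moreover have "\<exists>I. I \<in> K \<and> x \<in> cball (a I) (r I) \<and> r I < d" if "x \<in> S" "0 < d" for x d
  proof -
    obtain u w where I: "(u, w) \<in> K" "x \<in> {u..w}" "w - u < d"
      using S \<open>x \<in> S\<close> \<open>0 < d\<close> by blast
    then show ?thesis
      using K[OF I(1)] unfolding cb by (intro exI[of _ "(u, w)"]) (auto simp: r_def)
  qed
  ultimately obtain C where C: "countable C" "C \<subseteq> K"
    "pairwise (\<lambda>i j. disjnt (cball (a i) (r i)) (cball (a j) (r j))) C"
    "negligible (S - (\<Union>i \<in> C. cball (a i) (r i)))"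
    using Vitali_covering_theorem_cballs[of K r S a] by blast
  then show thesis
    by (intro that[of C]) (auto simp: cb disjoint_family_on_def pairwise_def disjnt_def)
qed

lemma negligible_if_on_intervals:
  fixes S :: "real set"
  assumes "\<And>a b. a < b \<Longrightarrow> negligible (S \<inter> {a<..<b})"
  shows "negligible S"
proof -
  have "\<exists>n::nat. t \<in> {- real (Suc n)<..<real (Suc n)}" for t :: real
  proof -
    obtain n where "\<bar>t\<bar> < real n"
      using reals_Archimedean2 by blast
    then show ?thesis
      by (intro exI[of _ n]) auto
  qed
  then have "S = (\<Union>n::nat. S \<inter> {- real (Suc n)<..<real (Suc n)})"
    by blast
  moreover have "negligible \<dots>"
    by (intro negligible_countable_Union countable_image) (auto intro!: assms)
  ultimately show ?thesis
    by simp
qed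

lemma emeasure_disjoint_intervals:
  assumes "countable C" "\<And>I. I \<in> C \<Longrightarrow> fst I < snd I"
    "disjoint_family_on (\<lambda>I. {fst I..snd I}) C"
  shows "emeasure lborel (\<Union>I\<in>C. {fst I..snd I}) =
    (\<integral>\<^sup>+I. ennreal (snd I - fst I) \<partial>count_space C)"
proof -
  have "emeasure lborel (\<Union>I\<in>C. {fst I..snd I}) =
      (\<integral>\<^sup>+I. emeasure lborel {fst I..snd I} \<partial>count_space C)"
    using assms by (intro emeasure_UN_countable) auto
  also have "\<dots> = (\<integral>\<^sup>+I. ennreal (snd I - fst I) \<partial>count_space C)"
    using assms by (intro nn_integral_cong) (auto simp: less_imp_le)
  finally show ?thesis .
qed

text \<open>
  A monotone function maps disjoint intervals to non-overlapping ones. Measuring the gaps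
  between the endpoint values replaces the Lebesgue-Stieltjes measure of \<open>\<phi>\<close>; jumps of \<open>\<phi>\<close> are gaps
  like any other.
\<close>

lemma emeasure_monotone_image_gaps:
  fixes \<phi> :: "real \<Rightarrow> real"
  assumes "mono \<phi>" "countable C" "\<And>I. I \<in> C \<Longrightarrow> fst I < snd I"
    "disjoint_family_on (\<lambda>I. {fst I..snd I}) C"
  shows "emeasure lborel (\<Union>I\<in>C. {\<phi> (fst I)<..<\<phi> (snd I)}) =
    (\<integral>\<^sup>+I. ennreal (\<phi> (snd I) - \<phi> (fst I)) \<partial>count_space C)"
proof -
  have "{\<phi> (fst I)<..<\<phi> (snd I)} \<inter> {\<phi> (fst J)<..<\<phi> (snd J)} = {}"
    if "I \<in> C" "J \<in> C" "I \<noteq> J" for I J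
  proof -
    have *: "{fst I..snd I} \<inter> {fst J..snd J} = {}" "fst I < snd I" "fst J < snd J"
      using assms that by (auto simp: disjoint_family_on_def)
    then have "snd I \<le> fst J \<or> snd J \<le> fst I"
    proof -
      have "max (fst I) (fst J) \<notin> {fst I..snd I} \<inter> {fst J..snd J}"
        using *(1) by blast
      then show ?thesis
        using *(2,3) by (auto simp: max_def split: if_splits)
    qed
    then have "\<phi> (snd I) \<le> \<phi> (fst J) \<or> \<phi> (snd J) \<le> \<phi> (fst I)"
      using monoD[OF \<open>mono \<phi>\<close>] by blast
    then show ?thesis
      by auto
  qed
  then have "disjoint_family_on (\<lambda>I. {\<phi> (fst I)<..<\<phi> (snd I)}) C"
    by (auto simp: disjoint_family_on_def)
  then have "emeasure lborel (\<Union>I\<in>C. {\<phi> (fst I)<..<\<phi> (snd I)}) =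
      (\<integral>\<^sup>+I. emeasure lborel {\<phi> (fst I)<..<\<phi> (snd I)} \<partial>count_space C)"
    using assms by (intro emeasure_UN_countable) auto
  also have "\<dots> = (\<integral>\<^sup>+I. ennreal (\<phi> (snd I) - \<phi> (fst I)) \<partial>count_space C)"
    using assms by (intro nn_integral_cong) (auto simp: less_imp_le monoD)
  finally show ?thesis .
qed

text \<open>
  For every \<open>M\<close>, each exceptional point lies in arbitrarily short intervals on which \<open>\<phi>\<close> grows by at
  least \<open>M\<close> times the length. Disjoint intervals of this kind in \<open>(a, b)\<close> have total length at most
  \<open>(\<phi> b - \<phi> a) / M\<close>, and by Vitali they cover almost all exceptional points.
\<close>

lemma monotone_pointwise_lipschitz_AE:
  fixes \<phi> :: "real \<Rightarrow> real"
  assumes "mono \<phi>"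
  shows "negligible {t. \<not> pointwise_lipschitz \<phi> t}"
proof -
  have bdd: "negligible ({t. \<not> pointwise_lipschitz \<phi> t} \<inter> {a<..<b})" (is "negligible ?S")
    if "a < b" for a b
    unfolding negligible_outer_le
  proof (intro allI impI)
    fix e :: real assume "e > 0"
    have inc: "\<phi> a \<le> \<phi> b"
      using \<open>mono \<phi>\<close> \<open>a < b\<close> by (simp add: monoD)
    define M where "M = (\<phi> b - \<phi> a) / e + 1"
    have "M > 0" "\<phi> b - \<phi> a \<le> M * e"
      using \<open>e > 0\<close> inc by (auto simp: M_def field_simps intro: add_nonneg_pos)
    define K where "K = {(u, w). u < w \<and> {u..w} \<subseteq> {a<..<b} \<and> M * (w - u) \<le> \<phi> w - \<phi> u}"
    have fine: "\<exists>u w. (u, w) \<in> K \<and> t \<in> {u..w} \<and> w - u < d" if "t \<in> ?S" "0 < d" for t d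
    proof -
      define d' where "d' = min d (min (t - a) (b - t))"
      have "d' > 0"
        using that by (auto simp: d'_def)
      moreover have "\<forall>C. \<forall>d>0. \<exists>h. norm h < d \<and> C * norm h < \<bar>\<phi> (t + h) - \<phi> t\<bar>"
        using that(1) by (simp add: pointwise_lipschitz_def not_le)
      ultimately have "\<exists>h. norm h < d' \<and> M * norm h < \<bar>\<phi> (t + h) - \<phi> t\<bar>"
        by simp
      then obtain h where h: "norm h < d'" "\<bar>\<phi> (t + h) - \<phi> t\<bar> > M * norm h"
        by (elim exE conjE)
      have "h \<noteq> 0" using h(2) by auto
      then consider "h > 0" | "h < 0" by linarith
      then show ?thesis
      proof cases
        case 1
        then have "\<phi> t \<le> \<phi> (t + h)"
          using \<open>mono \<phi>\<close> by (simp add: monoD)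
        then show ?thesis
          using h 1 by (intro exI[of _ t] exI[of _ "t + h"]) (auto simp: K_def d'_def)
      next
        case 2
        then have "\<phi> (t + h) \<le> \<phi> t"
          using \<open>mono \<phi>\<close> by (simp add: monoD)
        then show ?thesis
          using h 2 by (intro exI[of _ "t + h"] exI[of _ t]) (auto simp: K_def d'_def)
      qed
    qed
    obtain C where C: "countable C" "C \<subseteq> K" "disjoint_family_on (\<lambda>I. {fst I..snd I}) C"
      "negligible (?S - (\<Union>I\<in>C. {fst I..snd I}))"
      using Vitali_covering_intervals[of K ?S] fine by (auto simp: K_def)
    define U where "U = (\<Union>I\<in>C. {fst I..snd I})"
    have [measurable]: "U \<in> sets borel"
      unfolding U_def using C(1) by (intro sets.countable_UN') auto
    have lt: "fst I < snd I" if "I \<in> C" for I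
      using C(2) that by (auto simp: K_def)
    have "ennreal M * emeasure lborel U = (\<integral>\<^sup>+I. ennreal M * ennreal (snd I - fst I) \<partial>count_space C)"
      using emeasure_disjoint_intervals[OF C(1) lt C(3)] unfolding U_def[symmetric]
      by (simp add: nn_integral_cmult)
    also have "\<dots> \<le> (\<integral>\<^sup>+I. ennreal (\<phi> (snd I) - \<phi> (fst I)) \<partial>count_space C)"
    proof (intro nn_integral_mono)
      fix I assume "I \<in> space (count_space C)"
      then have "M * (snd I - fst I) \<le> \<phi> (snd I) - \<phi> (fst I)" "fst I < snd I"
        using C(2) by (auto simp: K_def)
      then show "ennreal M * ennreal (snd I - fst I) \<le> ennreal (\<phi> (snd I) - \<phi> (fst I))"
        using \<open>M > 0\<close> by (simp add: ennreal_mult[symmetric] ennreal_leI)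
    qed
    also have "\<dots> = emeasure lborel (\<Union>I\<in>C. {\<phi> (fst I)<..<\<phi> (snd I)})"
      by (rule emeasure_monotone_image_gaps[OF assms C(1) lt C(3), symmetric])
    also have "\<dots> \<le> emeasure lborel {\<phi> a..\<phi> b}"
    proof (intro emeasure_mono)
      have "{\<phi> (fst I)<..<\<phi> (snd I)} \<subseteq> {\<phi> a..\<phi> b}" if "I \<in> C" for I
      proof -
        have "a \<le> fst I" "snd I \<le> b"
        proof -
          have "{fst I..snd I} \<subseteq> {a<..<b}"
            using subsetD[OF C(2) that] by (simp add: K_def split_beta)
          then have "fst I \<in> {a<..<b}" "snd I \<in> {a<..<b}"
            using lt[OF that] by (meson atLeastAtMost_iff less_imp_le order_refl subsetD)+
          then show "a \<le> fst I" "snd I \<le> b"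
            by simp_all
        qed
        then have "\<phi> a \<le> \<phi> (fst I)" "\<phi> (snd I) \<le> \<phi> b"
          using \<open>mono \<phi>\<close> by (auto simp: monoD)
        then show ?thesis
          by auto
      qed
      then show "(\<Union>I\<in>C. {\<phi> (fst I)<..<\<phi> (snd I)}) \<subseteq> {\<phi> a..\<phi> b}"
        by blast
    qed simp
    also have "\<dots> = ennreal (\<phi> b - \<phi> a)"
      using inc by simp
    also have "\<dots> \<le> ennreal M * ennreal e"
      using \<open>\<phi> b - \<phi> a \<le> M * e\<close> \<open>M > 0\<close> \<open>e > 0\<close> by (simp add: ennreal_mult[symmetric] ennreal_leI)
    finally have small: "emeasure lborel U \<le> ennreal e"
      using \<open>M > 0\<close> by (simp add: ennreal_mult_le_mult_iff)
    have "U \<in> lmeasurable"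
      using small by (intro fmeasurableI) (auto simp: less_top[symmetric] top_unique)
    moreover have "?S - U \<in> lmeasurable" "measure lebesgue (?S - U) = 0"
      using C(4) unfolding U_def negligible_iff_measure by auto
    moreover have "measure lebesgue U \<le> e"
      using small \<open>e > 0\<close> by (simp add: measure_def enn2real_leI)
    moreover have "measure lebesgue ((?S - U) \<union> U) \<le> measure lebesgue (?S - U) + measure lebesgue U"
      using calculation by (intro measure_Un_le) (auto simp del: Un_Diff_cancel2)
    ultimately have "(?S - U) \<union> U \<in> lmeasurable" "measure lebesgue ((?S - U) \<union> U) \<le> e"
      by (auto simp del: Un_Diff_cancel2)
    then show "\<exists>T. ?S \<subseteq> T \<and> T \<in> lmeasurable \<and> measure lebesgue T \<le> e"
      by (intro exI[of _ "(?S - U) \<union> U"]) auto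
  qed
  show ?thesis
    by (rule negligible_if_on_intervals[OF bdd])
qed

text \<open>
  Lebesgue's argument. Cover almost all of the set, inside an open set of nearly the same measure,
  by disjoint intervals of slope below \<open>p\<close>; inside these cover it again by disjoint intervals of
  slope above \<open>q\<close>. Comparing total increments gives \<open>q |T| \<le> p (|T| + e)\<close> for all \<open>e > 0\<close>, so \<open>|T| = 0\<close>.
\<close>

lemma monotone_two_slopes_negligible:
  fixes \<phi> :: "real \<Rightarrow> real"
  assumes "mono \<phi>" "p < q" "S \<in> sets lebesgue"
    and low: "\<And>t. t \<in> S \<Longrightarrow> \<exists>\<^sub>F s in at 0. (\<phi> (t + s) - \<phi> t) / s < p"
    and high: "\<And>t. t \<in> S \<Longrightarrow> \<exists>\<^sub>F s in at 0. q < (\<phi> (t + s) - \<phi> t) / s"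
  shows "negligible S"
proof -
  have bdd: "negligible (S \<inter> {a<..<b})" for a b
  proof (rule ccontr)
    assume contra: "\<not> negligible (S \<inter> {a<..<b})"
    define T where "T = S \<inter> {a<..<b}"
    have T: "T \<in> lmeasurable"
      using assms(3) unfolding T_def
      by (subst Int_commute) (intro fmeasurable_Int_fmeasurable, auto)
    obtain t0 where "t0 \<in> T"
      using contra unfolding T_def by (metis all_not_in_conv negligible_empty)
    have "p > 0"
    proof -
      obtain s where s: "(\<phi> (t0 + s) - \<phi> t0) / s < p"
        using low[of t0] \<open>t0 \<in> T\<close> unfolding T_def by (auto dest: frequently_ex)
      have "0 \<le> (\<phi> (t0 + s) - \<phi> t0) / s"
        using monoD[OF \<open>mono \<phi>\<close>, of t0 "t0 + s"] monoD[OF \<open>mono \<phi>\<close>, of "t0 + s" t0]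
        by (cases "0 \<le> s") (auto simp: divide_simps)
      then show ?thesis
        using s by linarith
    qed
    then have "q > 0"
      using \<open>p < q\<close> by simp
    have sub: "\<exists>u w. u < w \<and> t \<in> {u..w} \<and> w - u < d \<and> {u..w} \<subseteq> V \<and> P ((\<phi> w - \<phi> u) / (w - u))"
      if freq: "\<exists>\<^sub>F s in at 0. P ((\<phi> (t + s) - \<phi> t) / s)" and "open V" "t \<in> V" "0 < d"
      for t d V P
    proof -
      obtain e where e: "e > 0" "cball t e \<subseteq> V"
        using \<open>open V\<close> \<open>t \<in> V\<close> open_contains_cball by blast
      have "min d e > 0" using e \<open>0 < d\<close> by simp
      then have "\<exists>s. s \<noteq> 0 \<and> \<bar>s\<bar> < min d e \<and> P ((\<phi> (t + s) - \<phi> t) / s)"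
        using freq unfolding frequently_at by (simp only: dist_real_def diff_0_right bex_UNIV)
      then obtain s where s: "s \<noteq> 0" "\<bar>s\<bar> < min d e" "P ((\<phi> (t + s) - \<phi> t) / s)"
        by (elim exE conjE)
      consider "s > 0" | "s < 0" using s(1) by linarith
      then show ?thesis
      proof cases
        case 1
        have "{t..t + s} \<subseteq> cball t e"
          using s 1 by (auto simp: cball_eq_atLeastAtMost)
        then show ?thesis
          using s 1 e by (intro exI[of _ t] exI[of _ "t + s"]) auto
      next
        case 2
        have "{t + s..t} \<subseteq> cball t e"
          using s 2 by (auto simp: cball_eq_atLeastAtMost)
        moreover have "(\<phi> t - \<phi> (t + s)) / (t - (t + s)) = (\<phi> (t + s) - \<phi> t) / s"
          using 2 by (simp add: divide_simps)
        ultimately show ?thesis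
          using s 2 e by (intro exI[of _ "t + s"] exI[of _ t]) auto
      qed
    qed
    have main: "q * measure lebesgue T \<le> p * (measure lebesgue T + e)" if "e > 0" for e
    proof -
      obtain V where V: "open V" "T \<subseteq> V" "V - T \<in> lmeasurable"
        "emeasure lebesgue (V - T) < ennreal e"
        using sets_lebesgue_outer_open[of T e] T \<open>e > 0\<close> by auto
      have emV: "emeasure lebesgue V \<le> ennreal (measure lebesgue T + e)"
      proof -
        have "V = T \<union> (V - T)" using V(2) by auto
        then have "emeasure lebesgue V \<le> emeasure lebesgue T + emeasure lebesgue (V - T)"
          using emeasure_subadditive[of T lebesgue "V - T"] T V(3) by auto
        also have "\<dots> \<le> ennreal (measure lebesgue T) + ennreal e"
          using V(4) T by (intro add_mono) (auto simp: emeasure_eq_measure2)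
        finally show ?thesis
          using \<open>e > 0\<close> by simp
      qed
      define K where "K = {(u, w). u < w \<and> {u..w} \<subseteq> V \<and> (\<phi> w - \<phi> u) / (w - u) < p}"
      have fine: "\<exists>u w. (u, w) \<in> K \<and> t \<in> {u..w} \<and> w - u < d" if "t \<in> T" "0 < d" for t d
      proof -
        note d = that(2)
        have "t \<in> S" "t \<in> V"
          using that V(2) by (auto simp: T_def)
        then obtain u w where "u < w" "t \<in> {u..w}" "w - u < d" "{u..w} \<subseteq> V"
          "(\<phi> w - \<phi> u) / (w - u) < p"
          using sub[of "\<lambda>x. x < p", OF low \<open>open V\<close> _ d, of t] by auto
        then show ?thesis
          by (intro exI[of _ u] exI[of _ w]) (simp add: K_def)
      qed
      have "u < w" if "(u, w) \<in> K" for u w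
        using that by (simp add: K_def)
      from Vitali_covering_intervals[OF this fine]
      obtain C where C: "countable C" "C \<subseteq> K" "disjoint_family_on (\<lambda>I. {fst I..snd I}) C"
        "negligible (T - (\<Union>I\<in>C. {fst I..snd I}))"
        by blast
      have ltC: "fst I < snd I" if "I \<in> C" for I
        using C(2) that by (auto simp: K_def)
      \<comment> \<open>The second covering needs open intervals around its points; only the countably many
          endpoints are lost.\<close>
      define W where "W = (\<Union>I\<in>C. {fst I<..<snd I})"
      define K' where "K' = {(u, w). u < w \<and> (\<exists>I\<in>C. {u..w} \<subseteq> {fst I<..<snd I}) \<and>
        q < (\<phi> w - \<phi> u) / (w - u)}"
      have fine': "\<exists>u w. (u, w) \<in> K' \<and> t \<in> {u..w} \<and> w - u < d" if "t \<in> T \<inter> W" "0 < d" for t d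
      proof -
        note t = that(1) and d = that(2)
        obtain I where I: "I \<in> C" "t \<in> {fst I<..<snd I}"
          using t by (auto simp: W_def)
        have "t \<in> S"
          using that by (simp add: T_def)
        then obtain u w where "u < w" "t \<in> {u..w}" "w - u < d" "{u..w} \<subseteq> {fst I<..<snd I}"
          "q < (\<phi> w - \<phi> u) / (w - u)"
          using sub[of "\<lambda>x. q < x", OF high open_greaterThanLessThan I(2) d] by blast
        then show ?thesis
          using I(1) by (intro exI[of _ u] exI[of _ w]) (auto simp: K'_def)
      qed
      have "u < w" if "(u, w) \<in> K'" for u w
        using that by (simp add: K'_def)
      from Vitali_covering_intervals[OF this fine']
      obtain C' where C': "countable C'" "C' \<subseteq> K'"
        "disjoint_family_on (\<lambda>I. {fst I..snd I}) C'"
        "negligible (T \<inter> W - (\<Union>I\<in>C'. {fst I..snd I}))"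
        by blast
      have ltC': "fst I < snd I" if "I \<in> C'" for I
        using C'(2) that by (auto simp: K'_def)
      define U where "U = (\<Union>I\<in>C. {fst I..snd I})"
      define U' where "U' = (\<Union>I\<in>C'. {fst I..snd I})"
      have [measurable]: "U \<in> sets borel" "U' \<in> sets borel"
        unfolding U_def U'_def using C(1) C'(1) by (auto intro!: sets.countable_UN')
      have "negligible (T - U')"
      proof -
        have "T - U' \<subseteq> (T - U) \<union> (T \<inter> W - U') \<union> (fst ` C \<union> snd ` C)"
        proof
          fix t assume t: "t \<in> T - U'"
          show "t \<in> (T - U) \<union> (T \<inter> W - U') \<union> (fst ` C \<union> snd ` C)"
          proof (cases "t \<in> U")
            case True
            then obtain I where I: "I \<in> C" "fst I \<le> t" "t \<le> snd I"
              by (auto simp: U_def)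
            show ?thesis
            proof (cases "t = fst I \<or> t = snd I")
              case False
              then have "t \<in> {fst I<..<snd I}"
                using I by auto
              then have "t \<in> W"
                using I(1) unfolding W_def by blast
              then show ?thesis
                using t by simp
            qed (use I in auto)
          qed (use t in auto)
        qed
        moreover have "negligible (fst ` C \<union> snd ` C)"
          using C(1) unfolding negligible_iff_null_sets
          by (intro null_sets_completionI countable_imp_null_set_lborel) auto
        ultimately show ?thesis
          using C(4) C'(4) negligible_subset unfolding U_def U'_def by (meson negligible_Un)
      qed
      have "emeasure lebesgue T \<le> emeasure lebesgue U'"
      proof -
        have "emeasure lebesgue T \<le> emeasure lebesgue (U' \<union> (T - U'))"
          using T by (intro emeasure_mono) (auto simp: negligible_imp_measurable fmeasurableD \<open>negligible (T - U')\<close>)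
        also have "\<dots> = emeasure lebesgue U'"
          using \<open>negligible (T - U')\<close> by (intro emeasure_Un_null_set) (auto simp: negligible_iff_null_sets)
        finally show ?thesis .
      qed
      then have "ennreal q * emeasure lebesgue T \<le> ennreal q * emeasure lborel U'"
        by (simp add: mult_left_mono)
      also have "\<dots> = (\<integral>\<^sup>+I. ennreal q * ennreal (snd I - fst I) \<partial>count_space C')"
        using emeasure_disjoint_intervals[OF C'(1) ltC' C'(3)] unfolding U'_def[symmetric]
        by (simp add: nn_integral_cmult)
      also have "\<dots> \<le> (\<integral>\<^sup>+I. ennreal (\<phi> (snd I) - \<phi> (fst I)) \<partial>count_space C')"
      proof (intro nn_integral_mono)
        fix I assume "I \<in> space (count_space C')"
        then have I: "q < (\<phi> (snd I) - \<phi> (fst I)) / (snd I - fst I)" "fst I < snd I"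
          using C'(2) by (auto simp: K'_def)
        then have "q * (snd I - fst I) \<le> \<phi> (snd I) - \<phi> (fst I)"
          by (simp add: field_simps)
        then show "ennreal q * ennreal (snd I - fst I) \<le> ennreal (\<phi> (snd I) - \<phi> (fst I))"
          using \<open>q > 0\<close> I by (simp add: ennreal_mult[symmetric] ennreal_leI)
      qed
      also have "\<dots> = emeasure lborel (\<Union>I\<in>C'. {\<phi> (fst I)<..<\<phi> (snd I)})"
        by (rule emeasure_monotone_image_gaps[OF assms(1) C'(1) ltC' C'(3), symmetric])
      also have "\<dots> \<le> emeasure lborel (\<Union>I\<in>C. {\<phi> (fst I)<..<\<phi> (snd I)})"
      proof (intro emeasure_mono)
        have "\<exists>J\<in>C. {\<phi> (fst I)<..<\<phi> (snd I)} \<subseteq> {\<phi> (fst J)<..<\<phi> (snd J)}" if "I \<in> C'" for I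
        proof -
          have "I \<in> K'"
            using C'(2) that by blast
          then obtain J where J: "J \<in> C" "{fst I..snd I} \<subseteq> {fst J<..<snd J}"
            unfolding K'_def split_beta by blast
          have "fst I \<in> {fst J<..<snd J}" "snd I \<in> {fst J<..<snd J}"
            using J(2) ltC'[OF that] by (meson atLeastAtMost_iff less_imp_le order_refl subsetD)+
          then have "fst J \<le> fst I" "snd I \<le> snd J"
            by simp_all
          then have "\<phi> (fst J) \<le> \<phi> (fst I)" "\<phi> (snd I) \<le> \<phi> (snd J)"
            using \<open>mono \<phi>\<close> by (auto simp: monoD)
          then have "{\<phi> (fst I)<..<\<phi> (snd I)} \<subseteq> {\<phi> (fst J)<..<\<phi> (snd J)}"
            by auto
          then show ?thesis
            using J(1) by blast
        qed
        then show "(\<Union>I\<in>C'. {\<phi> (fst I)<..<\<phi> (snd I)}) \<subseteq> (\<Union>I\<in>C. {\<phi> (fst I)<..<\<phi> (snd I)})"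
          by blast
      qed (use C(1) in \<open>auto intro!: sets.countable_UN'\<close>)
      also have "\<dots> = (\<integral>\<^sup>+I. ennreal (\<phi> (snd I) - \<phi> (fst I)) \<partial>count_space C)"
        by (rule emeasure_monotone_image_gaps[OF assms(1) C(1) ltC C(3)])
      also have "\<dots> \<le> (\<integral>\<^sup>+I. ennreal p * ennreal (snd I - fst I) \<partial>count_space C)"
      proof (intro nn_integral_mono)
        fix I assume "I \<in> space (count_space C)"
        then have I: "(\<phi> (snd I) - \<phi> (fst I)) / (snd I - fst I) < p" "fst I < snd I"
          using C(2) by (auto simp: K_def)
        then have "\<phi> (snd I) - \<phi> (fst I) \<le> p * (snd I - fst I)"
          by (simp add: field_simps)
        then show "ennreal (\<phi> (snd I) - \<phi> (fst I)) \<le> ennreal p * ennreal (snd I - fst I)"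
          using \<open>p > 0\<close> I by (simp add: ennreal_mult[symmetric] ennreal_leI)
      qed
      also have "\<dots> = ennreal p * emeasure lborel U"
        using emeasure_disjoint_intervals[OF C(1) ltC C(3)] unfolding U_def[symmetric]
        by (simp add: nn_integral_cmult)
      also have "emeasure lborel U \<le> emeasure lebesgue V"
      proof -
        have "U \<subseteq> V"
          unfolding U_def using C(2) unfolding K_def split_beta by blast
        then have "emeasure lborel U \<le> emeasure lborel V"
          using V(1) by (intro emeasure_mono) auto
        then show ?thesis
          using V(1) by simp
      qed
      then have "ennreal p * emeasure lborel U \<le> ennreal p * ennreal (measure lebesgue T + e)"
        using emV by (intro mult_left_mono) (auto intro: order_trans)
      finally have "ennreal q * ennreal (measure lebesgue T) \<le> ennreal p * ennreal (measure lebesgue T + e)"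
        using T by (simp add: emeasure_eq_measure2)
      then have "ennreal (q * measure lebesgue T) \<le> ennreal (p * (measure lebesgue T + e))"
        using \<open>p > 0\<close> \<open>q > 0\<close> \<open>e > 0\<close>
        by (simp add: ennreal_mult[symmetric] del: ennreal_plus)
      then show ?thesis
        using \<open>p > 0\<close> \<open>e > 0\<close> by (subst (asm) ennreal_le_iff) auto
    qed
    have "q * measure lebesgue T \<le> p * measure lebesgue T + e" if "e > 0" for e
    proof -
      have "q * measure lebesgue T \<le> p * (measure lebesgue T + e / p)"
        using main[of "e / p"] \<open>p > 0\<close> that by simp
      then show ?thesis
        using \<open>p > 0\<close> by (simp add: distrib_left)
    qed
    then have "q * measure lebesgue T \<le> p * measure lebesgue T"
      by (rule field_le_epsilon)
    then have "(q - p) * measure lebesgue T \<le> 0"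
      by (simp add: left_diff_distrib)
    then have "measure lebesgue T = 0"
      using \<open>p < q\<close> by (simp add: mult_le_0_iff antisym)
    then have "negligible T"
      using T by (simp add: negligible_iff_measure)
    then show False
      using contra by (simp add: T_def)
  qed
  show ?thesis
    by (rule negligible_if_on_intervals[OF bdd])
qed

section \<open>Aronszajn null sets\<close>

text \<open>
  Unlike \<^const>\<open>null_along\<close>, the case \<open>v = 0\<close> is not exempted: it forces \<open>E\<close> to be empty. With this
  convention a vector of the span never has to be checked for being nonzero.
\<close>

definition line_null :: "'a::real_normed_vector \<Rightarrow> 'a set \<Rightarrow> bool" where
  "line_null v E \<longleftrightarrow> (\<forall>x. {t :: real. x + t *\<^sub>R v \<in> E} \<in> null_sets lborel)"

text \<open>
  The requirement of Aronszajn nullity for one fixed sequence. Keeping the sequence fixed allows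
  to exhibit a set as a countable union whose pieces are chosen depending on the sequence.
\<close>

definition decomposable_along :: "(nat \<Rightarrow> 'a::real_normed_vector) \<Rightarrow> 'a set \<Rightarrow> bool" where
  "decomposable_along \<xi> E \<longleftrightarrow>
    (\<exists>A :: nat \<Rightarrow> 'a set. E = (\<Union>n. A n) \<and> (\<forall>n. A n \<in> sets borel \<and> null_along (\<xi> n) (A n)))"

lemma aronszajn_null_iff:
  "aronszajn_null E \<longleftrightarrow> E \<in> sets borel \<and>
    (\<forall>\<xi>. closure (span (range \<xi>)) = UNIV \<longrightarrow> decomposable_along \<xi> E)"
  by (simp add: aronszajn_null_def decomposable_along_def)

lemma line_in_borel:
  fixes E :: "'a::real_normed_vector set"
  assumes "E \<in> sets borel"
  shows "{t :: real. x + t *\<^sub>R v \<in> E} \<in> sets borel"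
proof -
  have "(\<lambda>t :: real. x + t *\<^sub>R v) \<in> borel_measurable borel"
    by (intro borel_measurable_continuous_onI continuous_intros)
  from measurable_sets[OF this assms] show ?thesis
    by (simp add: vimage_def)
qed

lemma null_along_subset:
  assumes "null_along v A" "B \<in> sets borel" "B \<subseteq> A"
  shows "null_along v B"
  unfolding null_along_def
proof (intro impI allI)
  fix x assume "v \<noteq> 0"
  then have "{t :: real. x + t *\<^sub>R v \<in> A} \<in> null_sets lborel"
    using assms(1) by (simp add: null_along_def)
  then show "{t :: real. x + t *\<^sub>R v \<in> B} \<in> null_sets lborel"
    by (rule null_sets_subset) (use line_in_borel[OF assms(2)] assms(3) in auto)
qed

lemma decomposable_along_subset:
  assumes "decomposable_along \<xi> E" "F \<in> sets borel" "F \<subseteq> E"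
  shows "decomposable_along \<xi> F"
proof -
  obtain A where A: "E = (\<Union>n. A n)" "\<And>n. A n \<in> sets borel" "\<And>n. null_along (\<xi> n) (A n)"
    using assms(1) unfolding decomposable_along_def by blast
  have "F = (\<Union>n. A n \<inter> F)"
    using A(1) assms(3) by blast
  moreover have "A n \<inter> F \<in> sets borel" "null_along (\<xi> n) (A n \<inter> F)" for n
    using A(2,3) assms(2) by (auto intro: null_along_subset)
  ultimately show ?thesis
    unfolding decomposable_along_def by blast
qed

lemma decomposable_along_UN:
  assumes "countable I" "\<And>i. i \<in> I \<Longrightarrow> decomposable_along \<xi> (E i)"
  shows "decomposable_along \<xi> (\<Union>i\<in>I. E i)"
proof -
  have "\<forall>i\<in>I. \<exists>A. E i = (\<Union>n. A n) \<and> (\<forall>n. A n \<in> sets borel \<and> null_along (\<xi> n) (A n))"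
    using assms(2) unfolding decomposable_along_def by blast
  from bchoice[OF this] obtain A where "\<forall>i\<in>I. E i = (\<Union>n. A i n) \<and>
      (\<forall>n. A i n \<in> sets borel \<and> null_along (\<xi> n) (A i n))" ..
  then have A: "\<And>i. i \<in> I \<Longrightarrow> E i = (\<Union>n. A i n)"
    "\<And>i n. i \<in> I \<Longrightarrow> A i n \<in> sets borel" "\<And>i n. i \<in> I \<Longrightarrow> null_along (\<xi> n) (A i n)"
    by simp_all
  have "(\<Union>i\<in>I. E i) = (\<Union>n. \<Union>i\<in>I. A i n)"
    using A(1) by auto
  moreover have "(\<Union>i\<in>I. A i n) \<in> sets borel" for n
    using assms(1) A(2) by (intro sets.countable_UN') auto
  moreover have "null_along (\<xi> n) (\<Union>i\<in>I. A i n)" for n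
    unfolding null_along_def
  proof (intro impI allI)
    fix x assume "\<xi> n \<noteq> 0"
    then have "(\<Union>i\<in>I. {t. x + t *\<^sub>R \<xi> n \<in> A i n}) \<in> null_sets lborel"
      using assms(1) A(3) by (intro null_sets_UN') (simp_all add: null_along_def)
    moreover have "(\<Union>i\<in>I. {t. x + t *\<^sub>R \<xi> n \<in> A i n}) = {t. x + t *\<^sub>R \<xi> n \<in> (\<Union>i\<in>I. A i n)}"
      by blast
    ultimately show "{t. x + t *\<^sub>R \<xi> n \<in> (\<Union>i\<in>I. A i n)} \<in> null_sets lborel"
      by simp
  qed
  ultimately show ?thesis
    unfolding decomposable_along_def by (intro exI[of _ "\<lambda>n. \<Union>i\<in>I. A i n"]) simp
qed

lemma aronszajn_null_subset:
  assumes "aronszajn_null E" "F \<in> sets borel" "F \<subseteq> E"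
  shows "aronszajn_null F"
  using assms decomposable_along_subset[OF _ assms(2,3)] unfolding aronszajn_null_iff by simp

lemma aronszajn_null_UN:
  assumes "countable I" "\<And>i. i \<in> I \<Longrightarrow> aronszajn_null (E i)"
  shows "aronszajn_null (\<Union>i\<in>I. E i)"
  unfolding aronszajn_null_iff
proof (intro conjI allI impI)
  show "(\<Union>i\<in>I. E i) \<in> sets borel"
    using assms by (intro sets.countable_UN') (auto simp: aronszajn_null_iff)
  show "decomposable_along \<xi> (\<Union>i\<in>I. E i)" if "closure (span (range \<xi>)) = UNIV" for \<xi>
    using assms that by (intro decomposable_along_UN) (simp_all add: aronszajn_null_iff)
qed

lemma aronszajn_null_Un:
  assumes "aronszajn_null A" "aronszajn_null B"
  shows "aronszajn_null (A \<union> B)"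
proof -
  have "aronszajn_null (\<Union>E\<in>{A, B}. E)"
    using assms by (intro aronszajn_null_UN) auto
  then show ?thesis
    by simp
qed

primrec iterated_integral ::
    "(nat \<Rightarrow> 'a::real_normed_vector) \<Rightarrow> nat \<Rightarrow> ('a \<Rightarrow> ennreal) \<Rightarrow> 'a \<Rightarrow> ennreal" where
  "iterated_integral \<xi> 0 u = u"
| "iterated_integral \<xi> (Suc k) u =
    (\<lambda>x. \<integral>\<^sup>+t. iterated_integral \<xi> k u (x + t *\<^sub>R \<xi> k) \<partial>lborel)"

lemma borel_measurable_line [measurable]:
  fixes u :: "'a::{real_normed_vector, second_countable_topology} \<Rightarrow> ennreal"
  assumes "u \<in> borel_measurable borel"
  shows "(\<lambda>(x, t). u (x + t *\<^sub>R v)) \<in> borel_measurable (borel \<Otimes>\<^sub>M lborel)"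
proof -
  have "(\<lambda>p :: 'a \<times> real. fst p + snd p *\<^sub>R v) \<in> borel_measurable borel"
    by (intro borel_measurable_continuous_onI continuous_intros)
  then have "(\<lambda>p :: 'a \<times> real. u (fst p + snd p *\<^sub>R v)) \<in> borel_measurable (borel \<Otimes>\<^sub>M borel)"
    using measurable_compose[OF _ assms] by (simp add: borel_prod)
  then show ?thesis
    by (simp add: split_beta cong: measurable_cong_sets)
qed

lemma borel_measurable_iterated_integral:
  fixes u :: "'a::{real_normed_vector, second_countable_topology} \<Rightarrow> ennreal"
  assumes "u \<in> borel_measurable borel"
  shows "iterated_integral \<xi> k u \<in> borel_measurable borel"
proof (induction k)
  case (Suc k)
  show ?case
    unfolding iterated_integral.simps
    by (intro lborel.borel_measurable_nn_integral borel_measurable_line[OF Suc])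
qed (simp add: assms)

text \<open>
  Each single integral runs over a whole line, so it is invariant under translation along that line;
  hence the iterated integral is invariant under the span of the directions used.
\<close>

lemma iterated_integral_translate:
  fixes u :: "'a::{real_normed_vector, second_countable_topology} \<Rightarrow> ennreal"
  assumes u: "u \<in> borel_measurable borel" and w: "w \<in> span (\<xi> ` {..<k})"
  shows "iterated_integral \<xi> k u (x + w) = iterated_integral \<xi> k u x"
proof -
  have gen: "iterated_integral \<xi> k u (x + c *\<^sub>R \<xi> i) = iterated_integral \<xi> k u x" if "i < k" for i c x
    using that
  proof (induction k arbitrary: x)
    case (Suc k)
    show ?case
    proof (cases "i = k")
      case True
      let ?g = "\<lambda>t. iterated_integral \<xi> k u (x + t *\<^sub>R \<xi> k)"
      have [measurable]: "?g \<in> borel_measurable borel"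
        by (rule measurable_compose[OF _ borel_measurable_iterated_integral[OF u]])
          (intro borel_measurable_continuous_onI continuous_intros)
      have "(\<integral>\<^sup>+t. ?g t \<partial>lborel) = (\<integral>\<^sup>+t. ?g (c + 1 * t) \<partial>lborel)"
        by (subst nn_integral_real_affine[where c = 1 and t = c]) auto
      also have "\<dots> = iterated_integral \<xi> (Suc k) u (x + c *\<^sub>R \<xi> k)"
        by (simp add: scaleR_left_distrib add.assoc)
      finally show ?thesis
        using True by simp
    next
      case False
      then have "iterated_integral \<xi> k u (x + c *\<^sub>R \<xi> i + t *\<^sub>R \<xi> k) =
          iterated_integral \<xi> k u (x + t *\<^sub>R \<xi> k)" for t
        using Suc.IH[of "x + t *\<^sub>R \<xi> k"] Suc.prems by (simp add: algebra_simps)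
      then show ?thesis
        by simp
    qed
  qed simp
  let ?T = "{w. \<forall>c x. iterated_integral \<xi> k u (x + c *\<^sub>R w) = iterated_integral \<xi> k u x}"
  have "subspace ?T"
    unfolding subspace_def
  proof (safe)
    fix v w c x
    assume "\<forall>c x. iterated_integral \<xi> k u (x + c *\<^sub>R v) = iterated_integral \<xi> k u x"
      "\<forall>c x. iterated_integral \<xi> k u (x + c *\<^sub>R w) = iterated_integral \<xi> k u x"
    then show "iterated_integral \<xi> k u (x + c *\<^sub>R (v + w)) = iterated_integral \<xi> k u x"
      by (simp add: scaleR_right_distrib add.assoc[symmetric])
  qed auto
  moreover have "\<xi> ` {..<k} \<subseteq> ?T"
    using gen by auto
  ultimately have "w \<in> ?T"
    using w span_minimal by blast
  then have "iterated_integral \<xi> k u (x + 1 *\<^sub>R w) = iterated_integral \<xi> k u x"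
    by blast
  then show ?thesis
    by simp
qed

lemma iterated_integral_swap:
  fixes u :: "'a::{real_normed_vector, second_countable_topology} \<Rightarrow> ennreal"
  assumes u: "u \<in> borel_measurable borel"
  shows "(\<integral>\<^sup>+s. iterated_integral \<xi> k u (x + s *\<^sub>R v) \<partial>lborel) =
    iterated_integral \<xi> k (\<lambda>y. \<integral>\<^sup>+s. u (y + s *\<^sub>R v) \<partial>lborel) x"
proof (induction k arbitrary: x)
  case (Suc k)
  let ?J = "iterated_integral \<xi> k u"
  have J: "?J \<in> borel_measurable borel"
    by (rule borel_measurable_iterated_integral[OF u])
  have "(\<lambda>p :: real \<times> real. x + fst p *\<^sub>R v + snd p *\<^sub>R \<xi> k) \<in> borel_measurable borel"
    by (intro borel_measurable_continuous_onI continuous_intros)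
  from measurable_compose[OF this J]
  have "(\<lambda>p :: real \<times> real. ?J (x + fst p *\<^sub>R v + snd p *\<^sub>R \<xi> k)) \<in>
      borel_measurable (borel \<Otimes>\<^sub>M borel)"
    by (simp add: borel_prod)
  then have "(\<lambda>(s, t). ?J (x + s *\<^sub>R v + t *\<^sub>R \<xi> k)) \<in> borel_measurable (lborel \<Otimes>\<^sub>M lborel)"
    by (simp add: split_beta cong: measurable_cong_sets)
  then have "(\<integral>\<^sup>+s. \<integral>\<^sup>+t. ?J (x + s *\<^sub>R v + t *\<^sub>R \<xi> k) \<partial>lborel \<partial>lborel) =
      (\<integral>\<^sup>+t. \<integral>\<^sup>+s. ?J (x + s *\<^sub>R v + t *\<^sub>R \<xi> k) \<partial>lborel \<partial>lborel)"
    by (rule lborel_pair.Fubini'[symmetric])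
  also have "\<dots> = (\<integral>\<^sup>+t. \<integral>\<^sup>+s. ?J ((x + t *\<^sub>R \<xi> k) + s *\<^sub>R v) \<partial>lborel \<partial>lborel)"
    by (simp add: algebra_simps)
  also have "\<dots> = iterated_integral \<xi> (Suc k) (\<lambda>y. \<integral>\<^sup>+s. u (y + s *\<^sub>R v) \<partial>lborel) x"
    by (simp add: Suc.IH)
  finally show ?case
    by simp
qed simp

lemma iterated_integral_zero [simp]: "iterated_integral \<xi> k (\<lambda>_. 0) = (\<lambda>_. 0)"
  by (induction k) auto

text \<open>
  Integrate the iterated integral once more, along \<open>v\<close>. By Tonelli the new integral can be done first,
  and it vanishes. As the iterated integral is constant along \<open>v\<close>, this constant is zero.
\<close>

lemma iterated_integral_null:
  fixes E :: "'a::{real_normed_vector, second_countable_topology} set"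
  assumes [measurable]: "E \<in> sets borel" and v: "v \<in> span (\<xi> ` {..<k})" "line_null v E"
  shows "iterated_integral \<xi> k (indicator E) x = 0"
proof -
  let ?J = "iterated_integral \<xi> k (indicator E)"
  have "(\<integral>\<^sup>+s. indicator E (y + s *\<^sub>R v) \<partial>lborel) = (0 :: ennreal)" for y
  proof -
    have "(\<integral>\<^sup>+s. indicator E (y + s *\<^sub>R v) \<partial>lborel) =
        (\<integral>\<^sup>+s. indicator {s. y + s *\<^sub>R v \<in> E} s \<partial>lborel)"
      by (intro nn_integral_cong) (auto simp: indicator_def)
    also have "\<dots> = emeasure lborel {s. y + s *\<^sub>R v \<in> E}"
      using line_in_borel[OF assms(1)] by (intro nn_integral_indicator) auto
    also have "\<dots> = 0"
      using v(2) by (auto simp: line_null_def)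
    finally show ?thesis .
  qed
  then have "0 = (\<integral>\<^sup>+s. ?J (x + s *\<^sub>R v) \<partial>lborel)"
    by (subst iterated_integral_swap) auto
  also have "\<dots> = (\<integral>\<^sup>+s. ?J x \<partial>lborel)"
    using v(1) by (simp add: iterated_integral_translate span_scale)
  finally show ?thesis
    by simp
qed

text \<open>
  Peel off directions one at a time. From what is left at stage \<open>n\<close>, remove the points whose line in
  direction \<open>\<xi> n\<close> meets it in measure zero; the removed part is null along \<open>\<xi> n\<close>. A point that
  survives \<open>k\<close> stages has a positive \<open>k\<close>-fold integral of the indicator of \<open>E\<close> along the first \<open>k\<close>
  directions, so nothing survives once these directions span \<open>v\<close>.
\<close>

lemma decomposable_along_if_line_null:
  fixes E :: "'a::{real_normed_vector, second_countable_topology} set"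
  assumes E: "E \<in> sets borel" and v: "v \<in> span (range \<xi>)" "line_null v E"
  shows "decomposable_along \<xi> E"
proof -
  have "\<exists>k. v \<in> span (\<xi> ` {..<k})"
  proof -
    obtain S where S: "finite S" "S \<subseteq> range \<xi>" "v \<in> span S"
    proof -
      obtain S r where "finite S" "S \<subseteq> range \<xi>" "v = (\<Sum>a\<in>S. r a *\<^sub>R a)"
        using v(1) unfolding span_explicit by auto
      moreover from this have "v \<in> span S"
        by (simp add: span_sum span_scale span_base)
      ultimately show thesis
        by (intro that)
    qed
    then obtain I where I: "finite I" "S = \<xi> ` I"
      by (meson finite_subset_image)
    then obtain k where "I \<subseteq> {..<k}"
      using finite_nat_iff_bounded by blast
    then have "S \<subseteq> \<xi> ` {..<k}"
      using I by blast
    then show ?thesis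
      using S(3) span_mono by blast
  qed
  then obtain k where k: "v \<in> span (\<xi> ` {..<k})" ..
  define P where "P = rec_nat E
    (\<lambda>k A. {x \<in> A. emeasure lborel {t. x + t *\<^sub>R \<xi> k \<in> A} \<noteq> 0})"
  have P0: "P 0 = E" and PS: "P (Suc n) = {x \<in> P n. emeasure lborel {t. x + t *\<^sub>R \<xi> n \<in> P n} \<noteq> 0}" for n
    by (simp_all add: P_def)
  have meas: "P n \<in> sets borel" for n
  proof (induction n)
    case (Suc n)
    let ?F = "\<lambda>x. \<integral>\<^sup>+t. indicator (P n) (x + t *\<^sub>R \<xi> n) \<partial>lborel"
    have "emeasure lborel {t. x + t *\<^sub>R \<xi> n \<in> P n} = ?F x" for x
    proof -
      have "?F x = (\<integral>\<^sup>+t. indicator {t. x + t *\<^sub>R \<xi> n \<in> P n} t \<partial>lborel)"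
        by (intro nn_integral_cong) (auto simp: indicator_def)
      also have "\<dots> = emeasure lborel {t. x + t *\<^sub>R \<xi> n \<in> P n}"
        using line_in_borel[OF Suc] by (intro nn_integral_indicator) auto
      finally show ?thesis ..
    qed
    then have eq: "P (Suc n) = P n \<inter> {x. ?F x \<noteq> 0}"
      by (auto simp: PS)
    have "(indicator (P n) :: 'a \<Rightarrow> ennreal) \<in> borel_measurable borel"
      using Suc by simp
    from lborel.borel_measurable_nn_integral[OF borel_measurable_line[OF this]]
    have [measurable]: "?F \<in> borel_measurable borel" .
    have "{x. ?F x \<noteq> 0} \<in> sets borel"
      by measurable
    then show ?case
      unfolding eq using Suc by blast
  qed (simp add: P0 E)
  have pos: "iterated_integral \<xi> n (indicator E) x \<noteq> 0" if "x \<in> P n" for n x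
    using that
  proof (induction n arbitrary: x)
    case (Suc n)
    let ?g = "\<lambda>t. iterated_integral \<xi> n (indicator E) (x + t *\<^sub>R \<xi> n)"
    have g: "?g \<in> borel_measurable lborel"
      by (rule measurable_compose[OF _ borel_measurable_iterated_integral])
        (use E in \<open>auto intro!: borel_measurable_continuous_onI continuous_intros\<close>)
    show ?case
    proof
      assume "iterated_integral \<xi> (Suc n) (indicator E) x = 0"
      then have "AE t in lborel. ?g t = 0"
        using nn_integral_0_iff_AE[OF g] by simp
      then have "AE t in lborel. x + t *\<^sub>R \<xi> n \<notin> P n"
        using Suc.IH by (auto elim!: eventually_mono)
      then have "emeasure lborel {t. x + t *\<^sub>R \<xi> n \<in> P n} = 0"
        using line_in_borel[OF meas[of n]] by (subst (asm) AE_iff_measurable[OF _ refl]) auto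
      then show False
        using Suc.prems by (simp add: PS)
    qed
  qed (simp add: P0)
  have empty: "P k = {}"
    using pos[of _ k] iterated_integral_null[OF E k v(2)] by blast
  define A where "A n = P n - P (Suc n)" for n
  have anti: "P n \<subseteq> E" for n
    by (induction n) (auto simp: P0 PS)
  have "E = (\<Union>n. A n)"
  proof
    show "E \<subseteq> (\<Union>n. A n)"
    proof
      fix x assume "x \<in> E"
      show "x \<in> (\<Union>n. A n)"
      proof (rule ccontr)
        assume *: "x \<notin> (\<Union>n. A n)"
        have "x \<in> P n" for n
          by (induction n) (use * \<open>x \<in> E\<close> in \<open>auto simp: P0 A_def\<close>)
        then show False
          using empty by blast
      qed
    qed
  qed (use anti in \<open>auto simp: A_def\<close>)
  moreover have "A n \<in> sets borel" for n
    using meas by (auto simp: A_def)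
  moreover have "null_along (\<xi> n) (A n)" for n
    unfolding null_along_def
  proof (intro impI allI)
    fix x
    have Am: "{t. x + t *\<^sub>R \<xi> n \<in> A n} \<in> sets lborel"
      using line_in_borel[of "A n"] meas by (auto simp: A_def)
    show "{t. x + t *\<^sub>R \<xi> n \<in> A n} \<in> null_sets lborel"
    proof (cases "\<exists>s. x + s *\<^sub>R \<xi> n \<in> A n")
      case False
      then have "{t. x + t *\<^sub>R \<xi> n \<in> A n} = {}"
        by simp
      then show ?thesis
        by (simp only: null_sets.empty_sets)
    next
      case True
      then obtain s where s: "x + s *\<^sub>R \<xi> n \<in> A n" ..
      let ?L = "{t. (x + s *\<^sub>R \<xi> n) + t *\<^sub>R \<xi> n \<in> P n}"
      have "emeasure lborel ?L = 0"
        using s by (auto simp: A_def PS)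
      then have null: "?L \<in> null_sets lborel"
        using line_in_borel[OF meas[of n], of "x + s *\<^sub>R \<xi> n" "\<xi> n"] by (auto simp: null_sets_def)
      have eq: "{t. x + t *\<^sub>R \<xi> n \<in> P n} = (+) s ` ?L"
      proof
        show "{t. x + t *\<^sub>R \<xi> n \<in> P n} \<subseteq> (+) s ` ?L"
        proof
          fix t assume "t \<in> {t. x + t *\<^sub>R \<xi> n \<in> P n}"
          then have "t - s \<in> ?L"
            by (simp add: scaleR_left_diff_distrib)
          then show "t \<in> (+) s ` ?L"
            by (intro image_eqI[of _ _ "t - s"]) auto
        qed
      qed (auto simp: scaleR_left_distrib add.assoc)
      have "negligible ?L"
        using null by (auto simp: negligible_iff_null_sets intro: null_sets_completionI)
      then have "negligible {t. x + t *\<^sub>R \<xi> n \<in> P n}"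
        unfolding eq by (rule negligible_translation)
      then have "negligible {t. x + t *\<^sub>R \<xi> n \<in> A n}"
        by (rule negligible_subset) (auto simp: A_def)
      then show ?thesis
        using Am by (auto simp: negligible_iff_null_sets null_sets_completion_iff)
    qed
  qed
  ultimately show ?thesis
    unfolding decomposable_along_def by blast
qed

section \<open>Rademacher's theorem for separable spaces\<close>

text \<open>
  A bounded function fails to converge only if its lower and upper limit differ, and then two
  rationals fit in between. The failure of convergence is thus a countable union of conditions on
  pairs of rationals, and this is how sets of nondifferentiability are seen to be Borel.
\<close>

lemma tendsto_if_no_two_slopes:
  fixes Q :: "'b \<Rightarrow> real"
  assumes "F \<noteq> bot" and bdd: "\<forall>\<^sub>F s in F. \<bar>Q s\<bar> \<le> C"
    and gap: "\<And>p q. p \<in> \<rat> \<Longrightarrow> q \<in> \<rat> \<Longrightarrow> p < q \<Longrightarrow>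
      (\<exists>\<^sub>F s in F. Q s < p) \<Longrightarrow> (\<exists>\<^sub>F s in F. q < Q s) \<Longrightarrow> False"
  shows "\<exists>l. (Q \<longlongrightarrow> l) F"
proof -
  let ?Q = "\<lambda>s. ereal (Q s)"
  have "Limsup F ?Q \<le> Liminf F ?Q"
  proof (rule ccontr)
    assume "\<not> Limsup F ?Q \<le> Liminf F ?Q"
    then obtain r1 where r1: "Liminf F ?Q < ereal (of_rat r1)" "ereal (of_rat r1) < Limsup F ?Q"
      using ereal_dense3 by (metis not_le)
    obtain r2 where r2: "ereal (of_rat r1) < ereal (of_rat r2)" "ereal (of_rat r2) < Limsup F ?Q"
      using ereal_dense3[OF r1(2)] by blast
    have "\<exists>\<^sub>F s in F. Q s < of_rat r1"
    proof (rule ccontr)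
      assume "\<not> (\<exists>\<^sub>F s in F. Q s < of_rat r1)"
      then have "\<forall>\<^sub>F s in F. ereal (of_rat r1) \<le> ?Q s"
        by (simp add: not_frequently not_less)
      then show False
        using Liminf_bounded r1(1) by (metis not_le)
    qed
    moreover have "\<exists>\<^sub>F s in F. of_rat r2 < Q s"
    proof (rule ccontr)
      assume "\<not> (\<exists>\<^sub>F s in F. of_rat r2 < Q s)"
      then have "\<forall>\<^sub>F s in F. ?Q s \<le> ereal (of_rat r2)"
        by (simp add: not_frequently not_less)
      then show False
        using Limsup_bounded r2(2) by (metis not_le)
    qed
    ultimately show False
      using gap[of "of_rat r1" "of_rat r2"] r2(1) by simp
  qed
  then have eq: "Liminf F ?Q = Limsup F ?Q"
    using Liminf_le_Limsup[OF \<open>F \<noteq> bot\<close>, of ?Q] by (intro antisym)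
  have "ereal (- C) \<le> Liminf F ?Q"
    using bdd by (intro Liminf_bounded) (auto elim!: eventually_mono)
  moreover have "Limsup F ?Q \<le> ereal C"
    using bdd by (intro Limsup_bounded) (auto elim!: eventually_mono)
  ultimately have "\<bar>Limsup F ?Q\<bar> \<noteq> \<infinity>"
    unfolding eq by auto
  then obtain l where "Limsup F ?Q = ereal l"
    by (cases "Limsup F ?Q") auto
  then have "(?Q \<longlongrightarrow> ereal l) F"
    using eq \<open>F \<noteq> bot\<close> by (simp add: tendsto_iff_Liminf_eq_Limsup del: lim_ereal)
  then show ?thesis
    by (auto simp: lim_ereal)
qed

lemma frequently_at_0_in_borel:
  fixes P :: "real \<Rightarrow> 'a::topological_space \<Rightarrow> bool"
  assumes "\<And>s. s \<noteq> 0 \<Longrightarrow> open {x. P s x}"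
  shows "{x. \<exists>\<^sub>F s in at 0. P s x} \<in> sets borel"
proof -
  let ?U = "\<lambda>n::nat. \<Union>s\<in>{s. s \<noteq> 0 \<and> \<bar>s\<bar> < 1 / real (Suc n)}. {x. P s x}"
  have "{x. \<exists>\<^sub>F s in at 0. P s x} = (\<Inter>n. ?U n)"
  proof (intro set_eqI iffI)
    fix x assume x: "x \<in> {x. \<exists>\<^sub>F s in at 0. P s x}"
    show "x \<in> (\<Inter>n. ?U n)"
    proof
      fix n :: nat
      have "0 < 1 / real (Suc n)"
        by simp
      then have "\<exists>s. s \<noteq> 0 \<and> \<bar>s\<bar> < 1 / real (Suc n) \<and> P s x"
        using x unfolding frequently_at mem_Collect_eq
        by (simp only: dist_real_def diff_0_right bex_UNIV)
      then show "x \<in> ?U n"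
        by blast
    qed
  next
    fix x assume x: "x \<in> (\<Inter>n. ?U n)"
    have "\<exists>s. s \<noteq> 0 \<and> \<bar>s\<bar> < d \<and> P s x" if "d > 0" for d
    proof -
      obtain n where n: "1 / real (Suc n) < d"
        using nat_approx_posE[OF \<open>d > 0\<close>] by blast
      have "x \<in> ?U n"
        using x by blast
      then obtain s where "s \<noteq> 0" "\<bar>s\<bar> < 1 / real (Suc n)" "P s x"
        by blast
      then show ?thesis
        using n by (intro exI[of _ s]) auto
    qed
    then show "x \<in> {x. \<exists>\<^sub>F s in at 0. P s x}"
      by (simp add: frequently_at)
  qed
  moreover have "?U n \<in> sets borel" for n
    by (intro borel_open open_UN ballI assms) auto
  ultimately show ?thesis
    by (simp add: sets.countable_INT'')
qed

definition quot :: "('a::real_vector \<Rightarrow> real) \<Rightarrow> 'a \<Rightarrow> 'a \<Rightarrow> real \<Rightarrow> real" where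
  "quot f x h s = (f (x + s *\<^sub>R h) - f x) / s"

definition differentiable_along :: "('a::real_vector \<Rightarrow> real) \<Rightarrow> 'a \<Rightarrow> 'a \<Rightarrow> bool" where
  "differentiable_along f h x \<longleftrightarrow> (\<exists>l. (quot f x h \<longlongrightarrow> l) (at 0))"

lemma has_gateaux_derivative_quot:
  "has_gateaux_derivative f L x \<longleftrightarrow> (\<forall>h. (quot f x h \<longlongrightarrow> blinfun_apply L h) (at 0))"
  by (simp add: has_gateaux_derivative_def quot_def[abs_def])

lemma lipschitz_infdist: "1-lipschitz_on UNIV (\<lambda>x. infdist x A)"
  using infdist_triangle_abs by (auto intro!: lipschitz_onI simp: dist_real_def)

lemma lipschitz_abs_diff:
  fixes f :: "'a::real_normed_vector \<Rightarrow> real"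
  assumes "C-lipschitz_on UNIV f"
  shows "\<bar>f x - f y\<bar> \<le> C * norm (x - y)"
  using lipschitz_onD[OF assms, of x y] by (simp add: dist_norm)

lemma quot_diff_le:
  fixes f :: "'a::real_normed_vector \<Rightarrow> real"
  assumes "C-lipschitz_on UNIV f" "s \<noteq> 0"
  shows "\<bar>quot f x h s - quot f x k s\<bar> \<le> C * norm (h - k)"
proof -
  have "quot f x h s - quot f x k s = (f (x + s *\<^sub>R h) - f (x + s *\<^sub>R k)) / s"
    by (simp add: quot_def diff_divide_distrib)
  moreover have "\<bar>f (x + s *\<^sub>R h) - f (x + s *\<^sub>R k)\<bar> \<le> \<bar>s\<bar> * (C * norm (h - k))"
    using lipschitz_abs_diff[OF assms(1), of "x + s *\<^sub>R h" "x + s *\<^sub>R k"]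
    by (simp add: scaleR_diff_right[symmetric] mult_ac)
  ultimately show ?thesis
    using assms(2) by (simp add: abs_divide divide_le_eq mult.commute)
qed

lemma abs_quot_le:
  fixes f :: "'a::real_normed_vector \<Rightarrow> real"
  assumes "C-lipschitz_on UNIV f" "s \<noteq> 0"
  shows "\<bar>quot f x h s\<bar> \<le> C * norm h"
  using quot_diff_le[OF assms, of x h 0] by (simp add: quot_def)

lemma continuous_quot:
  fixes f :: "'a::real_normed_vector \<Rightarrow> real"
  assumes "C-lipschitz_on UNIV f"
  shows "continuous_on UNIV (\<lambda>x. quot f x h s)"
proof -
  have f: "continuous_on UNIV f"
    by (rule lipschitz_on_continuous_on[OF assms])
  have "continuous_on UNIV (\<lambda>x. f (x + s *\<^sub>R h))"
    by (rule continuous_on_compose2[OF f]) (auto intro!: continuous_intros)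
  then show ?thesis
    unfolding quot_def divide_inverse by (intro continuous_intros f)
qed

definition two_slopes :: "('a::real_vector \<Rightarrow> real) \<Rightarrow> 'a \<Rightarrow> real \<Rightarrow> real \<Rightarrow> 'a set" where
  "two_slopes f h p q =
    {x. \<exists>\<^sub>F s in at 0. quot f x h s < p} \<inter> {x. \<exists>\<^sub>F s in at 0. q < quot f x h s}"

lemma two_slopes_borel:
  fixes f :: "'a::real_normed_vector \<Rightarrow> real"
  assumes "C-lipschitz_on UNIV f"
  shows "two_slopes f h p q \<in> sets borel"
proof -
  have "open {x. quot f x h s < p}" "open {x. q < quot f x h s}" for s
    by (intro open_Collect_less continuous_quot[OF assms] continuous_on_const)+
  then show ?thesis
    unfolding two_slopes_def by (intro sets.Int frequently_at_0_in_borel)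
qed

lemma not_differentiable_along_eq:
  fixes f :: "'a::real_normed_vector \<Rightarrow> real"
  assumes "C-lipschitz_on UNIV f"
  shows "{x. \<not> differentiable_along f h x} =
    (\<Union>p\<in>\<rat>. \<Union>q\<in>\<rat> \<inter> {p<..}. two_slopes f h p q)"
proof (intro set_eqI iffI)
  fix x assume x: "x \<in> {x. \<not> differentiable_along f h x}"
  have "\<forall>\<^sub>F s in at 0. \<bar>quot f x h s\<bar> \<le> C * norm h"
    using abs_quot_le[OF assms] by (auto simp: eventually_at_filter)
  from tendsto_if_no_two_slopes[OF at_neq_bot this] x
  show "x \<in> (\<Union>p\<in>\<rat>. \<Union>q\<in>\<rat> \<inter> {p<..}. two_slopes f h p q)"
    unfolding differentiable_along_def two_slopes_def by auto
next
  fix x assume "x \<in> (\<Union>p\<in>\<rat>. \<Union>q\<in>\<rat> \<inter> {p<..}. two_slopes f h p q)"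
  then obtain p q where pq: "p < q" "\<exists>\<^sub>F s in at 0. quot f x h s < p" "\<exists>\<^sub>F s in at 0. q < quot f x h s"
    by (auto simp: two_slopes_def)
  have "\<not> (quot f x h \<longlongrightarrow> l) (at 0)" for l
  proof
    assume l: "(quot f x h \<longlongrightarrow> l) (at 0)"
    show False
    proof (cases "p < l")
      case True
      then have "\<forall>\<^sub>F s in at 0. \<not> quot f x h s < p"
        using order_tendstoD(1)[OF l True] by (auto elim!: eventually_mono)
      then show False
        using pq(2) by (simp add: frequently_def)
    next
      case False
      then have "l < q"
        using pq(1) by simp
      then have "\<forall>\<^sub>F s in at 0. \<not> q < quot f x h s"
        using order_tendstoD(2)[OF l \<open>l < q\<close>] by (auto elim!: eventually_mono)
      then show False
        using pq(3) by (simp add: frequently_def)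
    qed
  qed
  then show "x \<in> {x. \<not> differentiable_along f h x}"
    by (simp add: differentiable_along_def)
qed

lemma not_differentiable_along_borel:
  fixes f :: "'a::real_normed_vector \<Rightarrow> real"
  assumes "C-lipschitz_on UNIV f"
  shows "{x. \<not> differentiable_along f h x} \<in> sets borel"
  unfolding not_differentiable_along_eq[OF assms]
  by (intro sets.countable_UN' image_subsetI two_slopes_borel[OF assms] countable_rat countable_Int1)

lemma line_null_UN:
  assumes "countable I" "\<And>i. i \<in> I \<Longrightarrow> line_null v (E i)"
  shows "line_null v (\<Union>i\<in>I. E i)"
  unfolding line_null_def
proof
  fix x
  have "(\<Union>i\<in>I. {t. x + t *\<^sub>R v \<in> E i}) \<in> null_sets lborel"
    using assms by (intro null_sets_UN') (simp_all add: line_null_def)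
  moreover have "(\<Union>i\<in>I. {t. x + t *\<^sub>R v \<in> E i}) = {t. x + t *\<^sub>R v \<in> (\<Union>i\<in>I. E i)}"
    by blast
  ultimately show "{t. x + t *\<^sub>R v \<in> (\<Union>i\<in>I. E i)} \<in> null_sets lborel"
    by simp
qed

lemma line_nullI:
  assumes "E \<in> sets borel" "\<And>x. negligible {t :: real. x + t *\<^sub>R v \<in> E}"
  shows "line_null v E"
  using assms line_in_borel[OF assms(1)] unfolding line_null_def
  by (simp add: negligible_iff_null_sets null_sets_completion_iff)

text \<open>
  On a line, adding a linear function of slope \<open>C * norm h\<close> to the Lipschitz function makes it monotone
  and shifts all difference quotients by a constant.
\<close>

lemma not_differentiable_along_line_null:
  fixes f :: "'a::real_normed_vector \<Rightarrow> real"
  assumes lip: "C-lipschitz_on UNIV f"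
  shows "line_null h {x. \<not> differentiable_along f h x}"
proof -
  have "line_null h (two_slopes f h p q)" if "p < q" for p q
  proof (rule line_nullI)
    show borel: "two_slopes f h p q \<in> sets borel"
      by (rule two_slopes_borel[OF lip])
    fix x
    define c where "c = C * norm h"
    define \<phi> where "\<phi> s = f (x + s *\<^sub>R h) + c * s" for s
    have "mono \<phi>"
    proof
      fix s t :: real assume "s \<le> t"
      have "f (x + s *\<^sub>R h) - f (x + t *\<^sub>R h) \<le> C * norm ((x + s *\<^sub>R h) - (x + t *\<^sub>R h))"
        using lipschitz_abs_diff[OF lip, of "x + s *\<^sub>R h" "x + t *\<^sub>R h"] by linarith
      also have "\<dots> = c * (t - s)"
        using \<open>s \<le> t\<close> by (simp add: c_def scaleR_left_diff_distrib[symmetric])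
      finally show "\<phi> s \<le> \<phi> t"
        by (simp add: \<phi>_def algebra_simps)
    qed
    have slope: "(\<phi> (t + s) - \<phi> t) / s = quot f (x + t *\<^sub>R h) h s + c" if "s \<noteq> 0" for s t
      using that by (simp add: \<phi>_def quot_def field_simps scaleR_left_distrib add.assoc)
    show "negligible {t :: real. x + t *\<^sub>R h \<in> two_slopes f h p q}"
    proof (rule monotone_two_slopes_negligible[OF \<open>mono \<phi>\<close>])
      show "p + c < q + c"
        using that by simp
      show "{t :: real. x + t *\<^sub>R h \<in> two_slopes f h p q} \<in> sets lebesgue"
        using line_in_borel[OF borel] by (simp add: sets_completionI_sets)
    next
      fix t assume "t \<in> {t :: real. x + t *\<^sub>R h \<in> two_slopes f h p q}"
      then have pq: "\<exists>\<^sub>F s in at 0. quot f (x + t *\<^sub>R h) h s < p"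
        "\<exists>\<^sub>F s in at 0. q < quot f (x + t *\<^sub>R h) h s"
        by (auto simp: two_slopes_def)
      have eq: "\<forall>\<^sub>F s in at 0. (\<phi> (t + s) - \<phi> t) / s = quot f (x + t *\<^sub>R h) h s + c"
        using slope by (simp add: eventually_at_filter)
      show "\<exists>\<^sub>F s in at 0. (\<phi> (t + s) - \<phi> t) / s < p + c"
        by (rule frequently_rev_mp[OF pq(1)]) (rule eventually_mono[OF eq], simp)
      show "\<exists>\<^sub>F s in at 0. q + c < (\<phi> (t + s) - \<phi> t) / s"
        by (rule frequently_rev_mp[OF pq(2)]) (rule eventually_mono[OF eq], simp)
    qed
  qed
  then show ?thesis
    unfolding not_differentiable_along_eq[OF lip]
    by (intro line_null_UN countable_rat countable_Int1) auto
qed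

text \<open>
  The distance has a minimum at points of \<open>A\<close>, so a directional derivative there can only be zero. This
  serves as a substitute for Lebesgue density: points of \<open>A\<close> occur within \<open>o(s)\<close> of \<open>x + s h\<close>.
\<close>

lemma infdist_quot_tendsto_0:
  fixes A :: "'a::real_normed_vector set"
  assumes "x \<in> A" "differentiable_along (\<lambda>y. infdist y A) h x"
  shows "((\<lambda>s. infdist (x + s *\<^sub>R h) A / s) \<longlongrightarrow> 0) (at 0)"
proof -
  obtain l where l: "((\<lambda>s. infdist (x + s *\<^sub>R h) A / s) \<longlongrightarrow> l) (at 0)"
    using assms by (auto simp: differentiable_along_def quot_def[abs_def])
  then have "DERIV (\<lambda>s. infdist (x + s *\<^sub>R h) A) 0 :> l"
    using assms(1) by (simp add: DERIV_def)
  then have "l = 0"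
    using assms(1) by (rule_tac DERIV_local_min[of _ _ _ 1]) (auto simp: infdist_nonneg)
  then show ?thesis
    using l by simp
qed

lemma infdist_less_ex:
  assumes "infdist x A < r" "A \<noteq> {}"
  obtains y where "y \<in> A" "dist x y < r"
proof -
  have "(INF a\<in>A. dist x a) < r"
    using assms by (simp add: infdist_notempty)
  then show thesis
    using assms(2) that by (subst (asm) cINF_less_iff) (auto intro!: bdd_belowI2[of _ 0])
qed

definition linear_approx_set ::
    "('a::real_normed_vector \<Rightarrow> real) \<Rightarrow> 'a \<Rightarrow> real \<Rightarrow> real \<Rightarrow> real \<Rightarrow> 'a set" where
  "linear_approx_set f k b e d = {y. \<forall>t. \<bar>t\<bar> < d \<longrightarrow> \<bar>f (y + t *\<^sub>R k) - f y - t * b\<bar> \<le> e * \<bar>t\<bar>}"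

lemma closed_linear_approx_set:
  fixes f :: "'a::real_normed_vector \<Rightarrow> real"
  assumes "C-lipschitz_on UNIV f"
  shows "closed (linear_approx_set f k b e d)"
proof -
  have f: "continuous_on UNIV f"
    by (rule lipschitz_on_continuous_on[OF assms])
  have eq: "linear_approx_set f k b e d =
      (\<Inter>t\<in>{t. \<bar>t\<bar> < d}. {y. \<bar>f (y + t *\<^sub>R k) - f y - t * b\<bar> \<le> e * \<bar>t\<bar>})"
    by (auto simp: linear_approx_set_def)
  have "continuous_on UNIV (\<lambda>y. f (y + t *\<^sub>R k))" for t
    by (rule continuous_on_compose2[OF f]) (auto intro!: continuous_intros)
  then show ?thesis
    unfolding eq by (intro closed_INT ballI closed_Collect_le continuous_intros f)
qed

text \<open>
  Moving by \<open>s (h + k)\<close> means moving by \<open>s h\<close> and then by \<open>s k\<close>. The second increment starts at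
  \<open>x + s h\<close>, not at \<open>x\<close>; but within \<open>o(s)\<close> there is a point \<open>y\<close> of a set on which increments along \<open>k\<close>
  are close to \<open>s b\<close> uniformly, and replacing \<open>x + s h\<close> by \<open>y\<close> costs only \<open>o(s)\<close> by the Lipschitz property.
\<close>

lemma quot_add_tendsto:
  fixes f :: "'a::real_normed_vector \<Rightarrow> real"
  assumes lip: "C-lipschitz_on UNIV f"
    and h: "(quot f x h \<longlongrightarrow> a) (at 0)" and k: "(quot f x k \<longlongrightarrow> b) (at 0)"
    and dense: "\<And>b j m. b \<in> \<rat> \<Longrightarrow>
      x \<in> linear_approx_set f k b (1 / real (Suc j)) (1 / real (Suc m)) \<Longrightarrow>
      differentiable_along
        (\<lambda>y. infdist y (linear_approx_set f k b (1 / real (Suc j)) (1 / real (Suc m)))) h x"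
  shows "(quot f x (h + k) \<longlongrightarrow> a + b) (at 0)"
proof (rule tendstoI)
  fix \<epsilon> :: real assume "\<epsilon> > 0"
  have "C \<ge> 0"
    using lip by (rule lipschitz_on_nonneg)
  \<comment> \<open>Five errors add up: two of size \<open>C e\<close> from replacing \<open>x + s h\<close> by \<open>y\<close>, and three of size \<open>e\<close> from
      the derivative along \<open>h\<close>, from the increment at \<open>y\<close>, and from rounding \<open>b\<close> to a rational.\<close>
  then have "\<epsilon> / (2 * C + 3) > 0"
    using \<open>\<epsilon> > 0\<close> by simp
  then obtain j where j: "1 / real (Suc j) < \<epsilon> / (2 * C + 3)"
    using nat_approx_posE by blast
  define e where "e = 1 / real (Suc j)"
  have e: "e > 0" "(2 * C + 3) * e < \<epsilon>"
    using j \<open>C \<ge> 0\<close> by (auto simp: e_def field_simps)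
  obtain b' where b': "b' \<in> \<rat>" "\<bar>b' - b\<bar> < e / 2"
  proof -
    have "b - e / 2 < b + e / 2"
      using e by simp
    then obtain b' where "b' \<in> \<rat>" "b - e / 2 < b'" "b' < b + e / 2"
      using Rats_dense_in_real by blast
    moreover from this have "\<bar>b' - b\<bar> < e / 2"
      by linarith
    ultimately show thesis
      by (intro that)
  qed
  have "\<forall>\<^sub>F s in at 0. dist (quot f x k s) b < e / 2"
    using tendstoD[OF k, of "e / 2"] e by simp
  then obtain d where d: "d > 0" "\<And>s. s \<noteq> 0 \<Longrightarrow> \<bar>s\<bar> < d \<Longrightarrow> \<bar>quot f x k s - b\<bar> < e / 2"
    unfolding eventually_at by (auto simp: dist_real_def)
  obtain m where m: "1 / real (Suc m) < d"
    using nat_approx_posE[OF d(1)] by blast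
  define A where "A = linear_approx_set f k b' e (1 / real (Suc m))"
  have "x \<in> A"
    unfolding A_def linear_approx_set_def
  proof (intro CollectI allI impI)
    fix t :: real assume t: "\<bar>t\<bar> < 1 / real (Suc m)"
    show "\<bar>f (x + t *\<^sub>R k) - f x - t * b'\<bar> \<le> e * \<bar>t\<bar>"
    proof (cases "t = 0")
      case False
      have "\<bar>quot f x k t - b'\<bar> \<le> e"
        using d(2)[OF False] t m b'(2) by linarith
      moreover have "f (x + t *\<^sub>R k) - f x - t * b' = (quot f x k t - b') * t"
        using False by (simp add: quot_def field_simps)
      ultimately show ?thesis
        by (simp add: abs_mult mult_right_mono)
    qed simp
  qed
  then have "((\<lambda>s. infdist (x + s *\<^sub>R h) A / s) \<longlongrightarrow> 0) (at 0)"
    using dense[OF b'(1), of j m] by (intro infdist_quot_tendsto_0) (auto simp: A_def e_def)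
  then have "\<forall>\<^sub>F s in at 0. dist (infdist (x + s *\<^sub>R h) A / s) 0 < e"
    using e(1) by (rule tendstoD)
  moreover have "\<forall>\<^sub>F s in at 0. dist (quot f x h s) a < e"
    using h e(1) by (rule tendstoD)
  moreover have "\<forall>\<^sub>F s in at 0. s \<noteq> 0 \<and> \<bar>s\<bar> < 1 / real (Suc m)"
    unfolding eventually_at by (intro exI[of _ "1 / real (Suc m)"]) (auto simp: dist_real_def)
  ultimately show "\<forall>\<^sub>F s in at 0. dist (quot f x (h + k) s) (a + b) < \<epsilon>"
  proof eventually_elim
    case (elim s)
    then have s: "s \<noteq> 0" "\<bar>s\<bar> < 1 / real (Suc m)"
      by simp_all
    have "infdist (x + s *\<^sub>R h) A < e * \<bar>s\<bar>"
      using elim(1) s(1) infdist_nonneg[of "x + s *\<^sub>R h" A]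
      by (simp add: dist_real_def abs_divide divide_less_eq)
    then obtain y where y: "y \<in> A" "dist (x + s *\<^sub>R h) y < e * \<bar>s\<bar>"
      using infdist_less_ex \<open>x \<in> A\<close> by blast
    have 1: "\<bar>f (x + s *\<^sub>R h + s *\<^sub>R k) - f (y + s *\<^sub>R k)\<bar> \<le> C * (e * \<bar>s\<bar>)"
      using lipschitz_abs_diff[OF lip, of "x + s *\<^sub>R h + s *\<^sub>R k" "y + s *\<^sub>R k"] y(2) \<open>C \<ge> 0\<close>
      by (simp add: dist_norm) (meson less_imp_le mult_left_mono order_trans)
    have 2: "\<bar>f (x + s *\<^sub>R h) - f y\<bar> \<le> C * (e * \<bar>s\<bar>)"
      using lipschitz_abs_diff[OF lip, of "x + s *\<^sub>R h" y] y(2) \<open>C \<ge> 0\<close>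
      by (simp add: dist_norm) (meson less_imp_le mult_left_mono order_trans)
    have 3: "\<bar>f (y + s *\<^sub>R k) - f y - s * b'\<bar> \<le> e * \<bar>s\<bar>"
      using y(1) s(2) by (simp add: A_def linear_approx_set_def)
    have 4: "\<bar>s * b' - s * b\<bar> \<le> e * \<bar>s\<bar>"
    proof -
      have "\<bar>s * b' - s * b\<bar> = \<bar>b' - b\<bar> * \<bar>s\<bar>"
        by (simp add: abs_mult[symmetric] algebra_simps)
      also have "\<dots> \<le> e * \<bar>s\<bar>"
        using b'(2) e(1) by (intro mult_right_mono) auto
      finally show ?thesis .
    qed
    have 5: "\<bar>f (x + s *\<^sub>R h) - f x - s * a\<bar> \<le> e * \<bar>s\<bar>"
    proof -
      have "f (x + s *\<^sub>R h) - f x - s * a = (quot f x h s - a) * s"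
        using s(1) by (simp add: quot_def field_simps)
      then show ?thesis
        using elim(2) by (simp add: abs_mult mult_right_mono dist_real_def)
    qed
    have eq: "f (x + s *\<^sub>R (h + k)) - f x - s * (a + b) =
        f (x + s *\<^sub>R h + s *\<^sub>R k) - f x - (s * a + s * b)"
      by (simp add: scaleR_right_distrib add.assoc distrib_left)
    have "\<bar>f (x + s *\<^sub>R (h + k)) - f x - s * (a + b)\<bar> \<le> 2 * (C * (e * \<bar>s\<bar>)) + 3 * (e * \<bar>s\<bar>)"
      using 1 2 3 4 5 unfolding eq abs_le_iff by linarith
    also have "\<dots> = ((2 * C + 3) * e) * \<bar>s\<bar>"
      by (simp add: algebra_simps)
    also have "\<dots> < \<epsilon> * \<bar>s\<bar>"
      using e(2) s(1) by simp
    finally have "\<bar>f (x + s *\<^sub>R (h + k)) - f x - s * (a + b)\<bar> / \<bar>s\<bar> < \<epsilon>"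
      using s(1) by (simp add: divide_less_eq)
    moreover have "quot f x (h + k) s - (a + b) = (f (x + s *\<^sub>R (h + k)) - f x - s * (a + b)) / s"
      using s(1) by (simp add: quot_def diff_divide_distrib)
    ultimately show ?case
      by (simp add: dist_real_def abs_divide)
  qed
qed

definition nonadditive :: "('a::real_vector \<Rightarrow> real) \<Rightarrow> 'a \<Rightarrow> 'a \<Rightarrow> 'a set" where
  "nonadditive f h k = (\<Union>j::nat. {x. \<exists>\<^sub>F s in at 0.
    1 / real (Suc j) < \<bar>quot f x (h + k) s - quot f x h s - quot f x k s\<bar>})"

lemma nonadditive_borel:
  fixes f :: "'a::real_normed_vector \<Rightarrow> real"
  assumes "C-lipschitz_on UNIV f"
  shows "nonadditive f h k \<in> sets borel"
proof -
  have "open {x. c < \<bar>quot f x (h + k) s - quot f x h s - quot f x k s\<bar>}" for c s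
    by (intro open_Collect_less continuous_intros continuous_quot[OF assms])
  then show ?thesis
    unfolding nonadditive_def by (intro sets.countable_UN') (auto intro!: frequently_at_0_in_borel)
qed

lemma not_in_nonadditive_iff:
  "x \<notin> nonadditive f h k \<longleftrightarrow>
    ((\<lambda>s. quot f x (h + k) s - quot f x h s - quot f x k s) \<longlongrightarrow> 0) (at 0)"
    (is "_ \<longleftrightarrow> (?Q \<longlongrightarrow> 0) _")
proof
  assume x: "x \<notin> nonadditive f h k"
  show "(?Q \<longlongrightarrow> 0) (at 0)"
  proof (rule tendstoI)
    fix e :: real assume "e > 0"
    then obtain j where j: "1 / real (Suc j) < e"
      using nat_approx_posE by blast
    have "\<forall>\<^sub>F s in at 0. \<not> 1 / real (Suc j) < \<bar>?Q s\<bar>"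
      using x by (simp add: nonadditive_def not_frequently)
    then show "\<forall>\<^sub>F s in at 0. dist (?Q s) 0 < e"
      using j by (auto elim!: eventually_mono simp: dist_real_def)
  qed
next
  assume Q: "(?Q \<longlongrightarrow> 0) (at 0)"
  have "\<forall>\<^sub>F s in at 0. \<not> 1 / real (Suc j) < \<bar>?Q s\<bar>" for j
    using tendstoD[OF Q, of "1 / real (Suc j)"] by (auto elim!: eventually_mono simp: dist_real_def)
  then show "x \<notin> nonadditive f h k"
    by (auto simp: nonadditive_def frequently_def)
qed

text \<open>
  Difference quotients of a Lipschitz function depend on the direction in a Lipschitz way,
  uniformly in the step. Existence of the limit and additivity therefore extend from a dense set
  of directions; homogeneity and boundedness are automatic.
\<close>

lemma gateaux_if_dense_directions:
  fixes f :: "'a::real_normed_vector \<Rightarrow> real"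
  assumes lip: "C-lipschitz_on UNIV f" and H: "closure H = UNIV"
    and diff: "\<And>h. h \<in> H \<Longrightarrow> differentiable_along f h x"
    and add: "\<And>h k. h \<in> H \<Longrightarrow> k \<in> H \<Longrightarrow> x \<notin> nonadditive f h k"
  shows "\<exists>L. has_gateaux_derivative f L x"
proof -
  have C: "C \<ge> 0"
    using lip by (rule lipschitz_on_nonneg)
  have near: "\<exists>h'\<in>H. C * norm (h - h') < e" if "e > 0" for h e
  proof -
    have "h \<in> closure H" "e / (C + 1) > 0"
      using H C that by auto
    then obtain h' where h': "h' \<in> H" "dist h' h < e / (C + 1)"
      unfolding closure_approachable by blast
    have "C * norm (h - h') \<le> (C + 1) * norm (h - h')"
      using C by (intro mult_right_mono) auto
    also have "\<dots> < e"
      using h'(2) C by (simp add: dist_norm norm_minus_commute field_simps)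
    finally show ?thesis
      using h'(1) by blast
  qed
  have "differentiable_along f h x" for h
  proof (rule ccontr)
    assume "\<not> differentiable_along f h x"
    then have "x \<in> (\<Union>p\<in>\<rat>. \<Union>q\<in>\<rat> \<inter> {p<..}. two_slopes f h p q)"
      using not_differentiable_along_eq[OF lip, of h] by blast
    then obtain p q where pq: "p < q" "\<exists>\<^sub>F s in at 0. quot f x h s < p"
      "\<exists>\<^sub>F s in at 0. q < quot f x h s"
      by (auto simp: two_slopes_def)
    define e where "e = (q - p) / 4"
    have "e > 0"
      using pq(1) by (simp add: e_def)
    obtain h' where h': "h' \<in> H" "C * norm (h - h') < e"
      using near[OF \<open>e > 0\<close>] by blast
    obtain l where "(quot f x h' \<longlongrightarrow> l) (at 0)"
      using diff[OF h'(1)] by (auto simp: differentiable_along_def)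
    then have "\<forall>\<^sub>F s in at 0. dist (quot f x h' s) l < e"
      using \<open>e > 0\<close> by (rule tendstoD)
    moreover have "\<forall>\<^sub>F s in at (0::real). s \<noteq> 0"
      by (simp add: eventually_at_filter)
    ultimately have ev: "\<forall>\<^sub>F s in at 0. \<bar>quot f x h s - l\<bar> < 2 * e"
    proof eventually_elim
      case (elim s)
      then show ?case
        using quot_diff_le[OF lip, of s x h h'] h'(2) unfolding dist_real_def by linarith
    qed
    obtain s where "quot f x h s < p" "\<bar>quot f x h s - l\<bar> < 2 * e"
      using frequently_ex[OF frequently_eventually_frequently[OF pq(2) ev]] by blast
    moreover obtain t where "q < quot f x h t" "\<bar>quot f x h t - l\<bar> < 2 * e"
      using frequently_ex[OF frequently_eventually_frequently[OF pq(3) ev]] by blast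
    ultimately have "q - p < 4 * e"
      by linarith
    then show False
      by (simp add: e_def)
  qed
  then obtain D where D: "\<And>h. (quot f x h \<longlongrightarrow> D h) (at 0)"
    unfolding differentiable_along_def by metis
  have additive: "D (h + k) = D h + D k" for h k
  proof -
    have lim: "((\<lambda>s. quot f x (h + k) s - quot f x h s - quot f x k s) \<longlongrightarrow> D (h + k) - D h - D k) (at 0)"
      by (intro tendsto_intros D)
    have "\<bar>D (h + k) - D h - D k\<bar> \<le> e" if "e > 0" for e
    proof -
      have "e / 5 > 0"
        using that by simp
      obtain h' where h': "h' \<in> H" "C * norm (h - h') < e / 5"
        using near[OF \<open>e / 5 > 0\<close>] by blast
      obtain k' where k': "k' \<in> H" "C * norm (k - k') < e / 5"
        using near[OF \<open>e / 5 > 0\<close>] by blast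
      have "C * norm ((h + k) - (h' + k')) \<le> C * (norm (h - h') + norm (k - k'))"
        using C norm_triangle_ineq[of "h - h'" "k - k'"]
        by (intro mult_left_mono) (auto simp: algebra_simps)
      then have hk: "C * norm ((h + k) - (h' + k')) < 2 * (e / 5)"
        using h'(2) k'(2) by (simp add: distrib_left)
      have "((\<lambda>s. quot f x (h' + k') s - quot f x h' s - quot f x k' s) \<longlongrightarrow> 0) (at 0)"
        using add[OF h'(1) k'(1)] by (simp only: not_in_nonadditive_iff)
      then have "\<forall>\<^sub>F s in at 0. dist (quot f x (h' + k') s - quot f x h' s - quot f x k' s) 0 < e / 5"
        using \<open>e / 5 > 0\<close> by (rule tendstoD)
      moreover have "\<forall>\<^sub>F s in at (0::real). s \<noteq> 0"
        by (simp add: eventually_at_filter)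
      ultimately have "\<forall>\<^sub>F s in at 0. \<bar>quot f x (h + k) s - quot f x h s - quot f x k s\<bar> \<le> e"
      proof eventually_elim
        case (elim s)
        then show ?case
          using quot_diff_le[OF lip, of s x h h'] quot_diff_le[OF lip, of s x k k']
            quot_diff_le[OF lip, of s x "h + k" "h' + k'"] h'(2) k'(2) hk
          unfolding dist_real_def by linarith
      qed
      then show ?thesis
        using tendsto_upperbound[OF tendsto_rabs[OF lim]] by simp
    qed
    then have "\<bar>D (h + k) - D h - D k\<bar> \<le> 0"
      by (rule field_le_epsilon[of _ 0, simplified])
    then show ?thesis
      by simp
  qed
  have scale: "D (c *\<^sub>R h) = c * D h" for c h
  proof (cases "c = 0")
    case True
    have "D (0 + 0) = D 0 + D 0"
      by (rule additive)
    then show ?thesis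
      using True by simp
  next
    case False
    have "filterlim (\<lambda>s. c * s) (at 0) (at (0::real))"
      using False by (auto simp: filterlim_at eventually_at_filter intro!: tendsto_eq_intros)
    from filterlim_compose[OF D[of h] this]
    have "((\<lambda>s. c * quot f x h (c * s)) \<longlongrightarrow> c * D h) (at 0)"
      by (intro tendsto_intros)
    moreover have "c * quot f x h (c * s) = quot f x (c *\<^sub>R h) s" for s
      using False by (simp add: quot_def mult.commute)
    ultimately have "(quot f x (c *\<^sub>R h) \<longlongrightarrow> c * D h) (at 0)"
      by simp
    then show ?thesis
      using D tendsto_unique[OF at_neq_bot] by blast
  qed
  have bound: "\<bar>D h\<bar> \<le> norm h * C" for h
  proof (rule tendsto_upperbound[OF tendsto_rabs[OF D[of h]]])
    show "\<forall>\<^sub>F s in at 0. \<bar>quot f x h s\<bar> \<le> norm h * C"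
      using abs_quot_le[OF lip] by (auto simp: eventually_at_filter mult.commute)
  qed simp
  have "bounded_linear D"
    using additive scale bound by (intro bounded_linear_intro[of D C]) auto
  then have "has_gateaux_derivative f (Blinfun D) x"
    using D by (simp add: has_gateaux_derivative_quot bounded_linear_Blinfun_apply)
  then show ?thesis
    by blast
qed

lemma not_gateaux_eq:
  fixes f :: "'a::real_normed_vector \<Rightarrow> real"
  assumes lip: "C-lipschitz_on UNIV f" and H: "closure H = UNIV"
  shows "{x. \<nexists>L. has_gateaux_derivative f L x} =
    (\<Union>h\<in>H. {x. \<not> differentiable_along f h x}) \<union> (\<Union>h\<in>H. \<Union>k\<in>H. nonadditive f h k)"
proof
  show "{x. \<nexists>L. has_gateaux_derivative f L x} \<subseteq>
    (\<Union>h\<in>H. {x. \<not> differentiable_along f h x}) \<union> (\<Union>h\<in>H. \<Union>k\<in>H. nonadditive f h k)"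
  proof
    fix x assume x: "x \<in> {x. \<nexists>L. has_gateaux_derivative f L x}"
    show "x \<in> (\<Union>h\<in>H. {x. \<not> differentiable_along f h x}) \<union> (\<Union>h\<in>H. \<Union>k\<in>H. nonadditive f h k)"
    proof (rule ccontr)
      assume "\<not> ?thesis"
      then have "\<exists>L. has_gateaux_derivative f L x"
        by (intro gateaux_if_dense_directions[OF lip H]) simp_all
      then show False
        using x by simp
    qed
  qed
next
  have "differentiable_along f h x" "x \<notin> nonadditive f h k" if "has_gateaux_derivative f L x" for L h k x
  proof -
    have L: "(quot f x h \<longlongrightarrow> blinfun_apply L h) (at 0)" for h
      using that by (simp add: has_gateaux_derivative_quot)
    then show "differentiable_along f h x"
      unfolding differentiable_along_def by blast
    have "((\<lambda>s. quot f x (h + k) s - quot f x h s - quot f x k s) \<longlongrightarrow>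
        blinfun_apply L (h + k) - blinfun_apply L h - blinfun_apply L k) (at 0)"
      by (intro tendsto_intros L)
    then show "x \<notin> nonadditive f h k"
      unfolding not_in_nonadditive_iff by (simp add: blinfun.add_right)
  qed
  then show "(\<Union>h\<in>H. {x. \<not> differentiable_along f h x}) \<union> (\<Union>h\<in>H. \<Union>k\<in>H. nonadditive f h k)
      \<subseteq> {x. \<nexists>L. has_gateaux_derivative f L x}"
    by fastforce
qed

text \<open>
  The exceptional set is described by a fixed dense set of directions, which shows that it is Borel.
  For a given sequence \<open>\<xi>\<close> the same set is described by a dense set of directions in the span of \<open>\<xi>\<close>.
  Its pieces are then null along vectors of this span.
\<close>

theorem lipschitz_gateaux_differentiable:
  fixes f :: "'a::{real_normed_vector, second_countable_topology} \<Rightarrow> real"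
  assumes lip: "C-lipschitz_on UNIV f"
  shows "aronszajn_null {x. \<nexists>L. has_gateaux_derivative f L x}" (is "aronszajn_null ?E")
  unfolding aronszajn_null_iff
proof (intro conjI allI impI)
  obtain H :: "'a set" where H: "countable H" "UNIV \<subseteq> closure H"
    by (rule separable[of "UNIV :: 'a set"])
  then have "closure H = UNIV"
    by auto
  then show borel: "?E \<in> sets borel"
    unfolding not_gateaux_eq[OF lip \<open>closure H = UNIV\<close>] using H(1)
    by (intro sets.Un sets.countable_UN' image_subsetI not_differentiable_along_borel[OF lip]
        nonadditive_borel[OF lip])
  fix \<xi> :: "nat \<Rightarrow> 'a"
  assume \<xi>: "closure (span (range \<xi>)) = UNIV"
  obtain H :: "'a set" where H: "countable H" "H \<subseteq> span (range \<xi>)" "span (range \<xi>) \<subseteq> closure H"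
    by (rule separable[of "span (range \<xi>)"])
  have dense: "closure H = UNIV"
    using closure_minimal[OF H(3)] \<xi> by auto
  define A where "A k i = (case i of (b, j, m) \<Rightarrow>
    linear_approx_set f k b (1 / real (Suc j)) (1 / real (Suc m)))" for k :: 'a and i :: "real \<times> nat \<times> nat"
  define I where "I = (\<rat> :: real set) \<times> (UNIV :: (nat \<times> nat) set)"
  have "countable I"
    by (simp add: I_def countable_rat)
  define N where "N h k i = A k i \<inter> {x. \<not> differentiable_along (\<lambda>y. infdist y (A k i)) h x}" for h k i
  have dec: "decomposable_along \<xi> {x. \<not> differentiable_along g h x}"
    if "h \<in> H" "D-lipschitz_on UNIV g" for g h D
    using that(1) H(2)
    by (intro decomposable_along_if_line_null[OF not_differentiable_along_borel[OF that(2)] _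
          not_differentiable_along_line_null[OF that(2)]]) (rule subsetD)
  have decN: "decomposable_along \<xi> (N h k i)" if "h \<in> H" for h k i
  proof (rule decomposable_along_subset[OF dec[OF that lipschitz_infdist[of "A k i"]]])
    have "closed (A k i)"
      by (cases i) (simp add: A_def closed_linear_approx_set[OF lip])
    then show "N h k i \<in> sets borel"
      unfolding N_def by (intro sets.Int not_differentiable_along_borel[OF lipschitz_infdist]) auto
  qed (auto simp: N_def)
  have "decomposable_along \<xi> ((\<Union>h\<in>H. {x. \<not> differentiable_along f h x}))"
    by (intro decomposable_along_UN H(1) dec[OF _ lip])
  moreover have "decomposable_along \<xi> (\<Union>h\<in>H. \<Union>k\<in>H. \<Union>i\<in>I. N h k i)"
    by (intro decomposable_along_UN H(1) \<open>countable I\<close> decN)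
  ultimately have "decomposable_along \<xi>
      (\<Union>E\<in>{\<Union>h\<in>H. {x. \<not> differentiable_along f h x}, \<Union>h\<in>H. \<Union>k\<in>H. \<Union>i\<in>I. N h k i}. E)"
    by (rule_tac decomposable_along_UN) (simp, elim insertE, simp_all)
  then show "decomposable_along \<xi> ?E"
  proof (rule decomposable_along_subset[OF _ borel])
    have "x \<notin> nonadditive f h k"
      if *: "h \<in> H" "k \<in> H" "differentiable_along f h x" "differentiable_along f k x"
        "\<And>i. i \<in> I \<Longrightarrow> x \<notin> N h k i" for x h k
    proof -
      obtain a b where ab: "(quot f x h \<longlongrightarrow> a) (at 0)" "(quot f x k \<longlongrightarrow> b) (at 0)"
        using *(3,4) by (auto simp: differentiable_along_def)
      have "(quot f x (h + k) \<longlongrightarrow> a + b) (at 0)"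
      proof (rule quot_add_tendsto[OF lip ab])
        fix b' :: real and j m
        assume "b' \<in> \<rat>" "x \<in> linear_approx_set f k b' (1 / real (Suc j)) (1 / real (Suc m))"
        then show "differentiable_along
            (\<lambda>y. infdist y (linear_approx_set f k b' (1 / real (Suc j)) (1 / real (Suc m)))) h x"
          using *(5)[of "(b', j, m)"] by (simp add: N_def A_def I_def)
      qed
      then have "((\<lambda>s. quot f x (h + k) s - quot f x h s - quot f x k s) \<longlongrightarrow> (a + b) - a - b) (at 0)"
        by (intro tendsto_intros ab)
      then show ?thesis
        by (simp add: not_in_nonadditive_iff)
    qed
    note add = this
    show "?E \<subseteq> (\<Union>E\<in>{\<Union>h\<in>H. {x. \<not> differentiable_along f h x}, \<Union>h\<in>H. \<Union>k\<in>H. \<Union>i\<in>I. N h k i}. E)"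
    proof
      fix x assume "x \<in> ?E"
      show "x \<in> (\<Union>E\<in>{\<Union>h\<in>H. {x. \<not> differentiable_along f h x}, \<Union>h\<in>H. \<Union>k\<in>H. \<Union>i\<in>I. N h k i}. E)"
      proof (rule ccontr)
        assume *: "\<not> ?thesis"
        then have diff: "\<And>h. h \<in> H \<Longrightarrow> differentiable_along f h x"
          and "\<And>h k i. h \<in> H \<Longrightarrow> k \<in> H \<Longrightarrow> i \<in> I \<Longrightarrow> x \<notin> N h k i"
          by simp_all
        then have "\<exists>L. has_gateaux_derivative f L x"
          by (intro gateaux_if_dense_directions[OF lip dense] add) simp_all
        then show False
          using \<open>x \<in> ?E\<close> by simp
      qed
    qed
  qed
qed

section \<open>Stepanov's theorem for separable spaces\<close>

text \<open>By the uniform Lipschitz dependence on the direction, a finite net of \<open>K\<close> controls all of \<open>K\<close>.\<close>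

lemma lipschitz_gateaux_uniform_on_compact:
  fixes f :: "'a::real_normed_vector \<Rightarrow> real"
  assumes lip: "C-lipschitz_on UNIV f" and L: "has_gateaux_derivative f L x" and "compact K"
  shows "uniform_limit K (\<lambda>t h. quot f x h t) (blinfun_apply L) (at 0)"
proof (rule uniform_limitI)
  fix e :: real assume "e > 0"
  have "C \<ge> 0"
    using lip by (rule lipschitz_on_nonneg)
  define B where "B = C + norm L + 1"
  define \<eta> where "\<eta> = e / (3 * B)"
  have "B > 0"
    using \<open>C \<ge> 0\<close> norm_ge_zero[of L] unfolding B_def by linarith
  then have "\<eta> > 0" "B * \<eta> = e / 3"
    using \<open>e > 0\<close> by (simp_all add: \<eta>_def)
  then have small: "C * \<eta> + norm L * \<eta> \<le> e / 3"
    by (simp add: B_def distrib_right)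
  obtain F where F: "finite F" "K \<subseteq> (\<Union>k\<in>F. ball k \<eta>)"
  proof (rule compactE_image[OF \<open>compact K\<close>, of K "\<lambda>k. ball k \<eta>"])
    show "K \<subseteq> (\<Union>k\<in>K. ball k \<eta>)"
      using \<open>\<eta> > 0\<close> by auto
  qed auto
  have "\<forall>\<^sub>F t in at 0. \<forall>k\<in>F. dist (quot f x k t) (blinfun_apply L k) < e / 3"
  proof (intro eventually_ball_finite ballI F(1))
    fix k
    have "(quot f x k \<longlongrightarrow> blinfun_apply L k) (at 0)"
      using L by (simp add: has_gateaux_derivative_quot)
    then show "\<forall>\<^sub>F t in at 0. dist (quot f x k t) (blinfun_apply L k) < e / 3"
      by (rule tendstoD) (use \<open>e > 0\<close> in simp)
  qed
  moreover have "\<forall>\<^sub>F t in at (0::real). t \<noteq> 0"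
    by (simp add: eventually_at_filter)
  ultimately show "\<forall>\<^sub>F t in at 0. \<forall>h\<in>K. dist (quot f x h t) (blinfun_apply L h) < e"
  proof eventually_elim
    case (elim t)
    show ?case
    proof
      fix h assume "h \<in> K"
      then obtain k where k: "k \<in> F" "norm (h - k) < \<eta>"
        using F(2) by (auto simp: dist_norm norm_minus_commute)
      have "\<bar>quot f x h t - quot f x k t\<bar> \<le> C * norm (h - k)"
        using elim(2) by (rule quot_diff_le[OF lip])
      moreover have "C * norm (h - k) \<le> C * \<eta>"
        using k(2) \<open>C \<ge> 0\<close> by (intro mult_left_mono) auto
      moreover have "\<bar>blinfun_apply L h - blinfun_apply L k\<bar> \<le> norm L * norm (h - k)"
        using norm_blinfun[of L "h - k"] by (simp add: blinfun.diff_right)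
      moreover have "norm L * norm (h - k) \<le> norm L * \<eta>"
        using k(2) by (intro mult_left_mono) auto
      moreover have "\<bar>quot f x k t - blinfun_apply L k\<bar> < e / 3"
        using elim(1) k(1) by (simp add: dist_real_def)
      ultimately show "dist (quot f x h t) (blinfun_apply L h) < e"
        using small \<open>e > 0\<close> unfolding dist_real_def by linarith
    qed
  qed
qed

text \<open>
  For nonempty \<open>A\<close> this is the McShane extension, the largest function with Lipschitz constant \<open>C\<close>
  that agrees with \<open>g\<close> on \<open>A\<close>.
\<close>

lemma lipschitz_extension:
  fixes g :: "'a::metric_space \<Rightarrow> real"
  assumes "C \<ge> 0" and g: "\<And>x y. x \<in> A \<Longrightarrow> y \<in> A \<Longrightarrow> \<bar>g x - g y\<bar> \<le> C * dist x y"
  shows "\<exists>G. C-lipschitz_on UNIV G \<and> (\<forall>x\<in>A. G x = g x)"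
proof (cases "A = {}")
  case True
  have "C-lipschitz_on UNIV (\<lambda>x. 0 :: real)"
    using \<open>C \<ge> 0\<close> by (auto intro!: lipschitz_onI)
  then show ?thesis
    using True by (intro exI[of _ "\<lambda>x. 0"]) simp
next
  case False
  define G where "G y = (INF a\<in>A. g a + C * dist y a)" for y
  have bdd: "bdd_below ((\<lambda>a. g a + C * dist y a) ` A)" for y
  proof -
    obtain a0 where "a0 \<in> A"
      using False by blast
    have "g a0 - C * dist y a0 \<le> g a + C * dist y a" if "a \<in> A" for a
    proof -
      have "g a0 - g a \<le> C * dist a0 a"
        using g[OF \<open>a0 \<in> A\<close> that] by linarith
      also have "\<dots> \<le> C * (dist y a0 + dist y a)"
        using \<open>C \<ge> 0\<close> dist_triangle3[of a0 a y] by (intro mult_left_mono) auto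
      finally show ?thesis
        by (simp add: distrib_left)
    qed
    then show ?thesis
      by (rule bdd_belowI2)
  qed
  have le: "G y \<le> G z + C * dist y z" for y z
  proof -
    have "G y - C * dist y z \<le> g a + C * dist z a" if "a \<in> A" for a
    proof -
      have "G y \<le> g a + C * dist y a"
        unfolding G_def using bdd that by (rule cINF_lower)
      also have "C * dist y a \<le> C * (dist y z + dist z a)"
        using \<open>C \<ge> 0\<close> by (intro mult_left_mono dist_triangle) auto
      finally show ?thesis
        by (simp add: distrib_left)
    qed
    then have "G y - C * dist y z \<le> G z"
      unfolding G_def[of z] using False by (intro cINF_greatest)
    then show ?thesis
      by simp
  qed
  have "C-lipschitz_on UNIV G"
  proof (rule lipschitz_onI)
    fix x y
    show "dist (G x) (G y) \<le> C * dist x y"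
      using le[of x y] le[of y x] by (auto simp: dist_real_def dist_commute)
  qed (rule \<open>C \<ge> 0\<close>)
  moreover have "G x = g x" if "x \<in> A" for x
  proof (rule antisym)
    have "G x \<le> g x + C * dist x x"
      unfolding G_def using bdd that by (rule cINF_lower)
    then show "G x \<le> g x"
      by simp
    have "g x \<le> g a + C * dist x a" if "a \<in> A" for a
      using g[OF \<open>x \<in> A\<close> that] by linarith
    then show "g x \<le> G x"
      unfolding G_def using False by (intro cINF_greatest)
  qed
  ultimately show ?thesis
    by (intro exI[of _ G]) simp
qed

text \<open>
  One index bounds the Lipschitz constant and the radius at the same time, so that countably many
  sets exhaust the pointwise Lipschitz points.
\<close>

definition lipschitz_points :: "('a::real_normed_vector \<Rightarrow> real) \<Rightarrow> nat \<Rightarrow> 'a set" where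
  "lipschitz_points f n =
    {x. \<forall>h. norm h < 1 / real (Suc n) \<longrightarrow> \<bar>f (x + h) - f x\<bar> \<le> real n * norm h}"

lemma pointwise_lipschitz_iff: "pointwise_lipschitz f x \<longleftrightarrow> (\<exists>n. x \<in> lipschitz_points f n)"
proof
  assume "pointwise_lipschitz f x"
  then obtain C d where d: "d > 0" and C: "\<And>h. norm h < d \<Longrightarrow> \<bar>f (x + h) - f x\<bar> \<le> C * norm h"
    unfolding pointwise_lipschitz_def by blast
  obtain n1 where n1: "1 / real (Suc n1) < d"
    using nat_approx_posE[OF d] by blast
  obtain n2 where n2: "C < real n2"
    using reals_Archimedean2 by blast
  define n where "n = max n1 n2"
  have "x \<in> lipschitz_points f n"
    unfolding lipschitz_points_def
  proof (intro CollectI allI impI)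
    fix h :: 'a assume h: "norm h < 1 / real (Suc n)"
    have "1 / real (Suc n) \<le> 1 / real (Suc n1)"
      by (simp add: n_def divide_simps)
    then have "\<bar>f (x + h) - f x\<bar> \<le> C * norm h"
      using C h n1 by simp
    also have "\<dots> \<le> real n * norm h"
      using n2 by (intro mult_right_mono) (auto simp: n_def)
    finally show "\<bar>f (x + h) - f x\<bar> \<le> real n * norm h" .
  qed
  then show "\<exists>n. x \<in> lipschitz_points f n"
    by blast
next
  assume "\<exists>n. x \<in> lipschitz_points f n"
  then obtain n where "x \<in> lipschitz_points f n" ..
  then show "pointwise_lipschitz f x"
    unfolding pointwise_lipschitz_def lipschitz_points_def
    by (intro exI[of _ "real n"] exI[of _ "1 / real (Suc n)"]) simp
qed

text \<open>
  The defining estimates at \<open>X i\<close> apply to the limit point \<open>x\<close> itself and give \<open>f (X i) \<longlonglongrightarrow> f x\<close>,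
  after which they pass to the limit. This makes the set of pointwise Lipschitz points Borel for
  an arbitrary \<open>f\<close>.
\<close>

lemma closed_lipschitz_points: "closed (lipschitz_points f n)"
  unfolding closed_sequential_limits
proof (intro allI impI, elim conjE)
  fix X x assume X: "\<forall>i. X i \<in> lipschitz_points f n" and lim: "X \<longlonglongrightarrow> x"
  have val: "(\<lambda>i. \<bar>f (x + h) - f (X i)\<bar>) \<longlonglongrightarrow> \<bar>f (x + h) - l\<bar>"
    if "(\<lambda>i. f (X i)) \<longlonglongrightarrow> l" for h l
    by (intro tendsto_intros that)
  have "(\<lambda>i. norm ((x + h) - X i)) \<longlonglongrightarrow> norm ((x + h) - x)" for h
    by (intro tendsto_intros lim)
  then have nrm: "(\<lambda>i. norm ((x + h) - X i)) \<longlonglongrightarrow> norm h" for h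
    by simp
  have bound: "\<forall>\<^sub>F i in sequentially. \<bar>f (x + h) - f (X i)\<bar> \<le> real n * norm ((x + h) - X i)"
    if "norm h < 1 / real (Suc n)" for h
    using order_tendstoD(2)[OF nrm that]
  proof eventually_elim
    case (elim i)
    then have "\<bar>f (X i + ((x + h) - X i)) - f (X i)\<bar> \<le> real n * norm ((x + h) - X i)"
      using X unfolding lipschitz_points_def by blast
    then show ?case
      by simp
  qed
  have "(\<lambda>i. real n * norm ((x + 0) - X i)) \<longlonglongrightarrow> real n * norm (0 :: 'a)"
    by (intro tendsto_mult tendsto_const nrm)
  then have "(\<lambda>i. real n * norm (x - X i)) \<longlonglongrightarrow> 0"
    by simp
  then have "(\<lambda>i. f x - f (X i)) \<longlonglongrightarrow> 0"
    using bound[of 0] by (rule_tac Lim_null_comparison[rotated]) simp_all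
  then have fX: "(\<lambda>i. f (X i)) \<longlonglongrightarrow> f x"
    using tendsto_diff[OF tendsto_const[of "f x"]] by fastforce
  show "x \<in> lipschitz_points f n"
    unfolding lipschitz_points_def
  proof (intro CollectI allI impI)
    fix h :: 'a assume h: "norm h < 1 / real (Suc n)"
    show "\<bar>f (x + h) - f x\<bar> \<le> real n * norm h"
      by (rule tendsto_le[OF sequentially_bot tendsto_mult[OF tendsto_const nrm] val[OF fX] bound[OF h]])
  qed
qed

lemma pointwise_lipschitz_borel: "{x. pointwise_lipschitz f x} \<in> sets borel"
proof -
  have "{x. pointwise_lipschitz f x} = (\<Union>n. lipschitz_points f n)"
    using pointwise_lipschitz_iff[of f] by blast
  moreover have "lipschitz_points f n \<in> sets borel" for n
    by (rule borel_closed[OF closed_lipschitz_points])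
  ultimately show ?thesis
    by (simp add: sets.countable_UN)
qed

text \<open>
  Near \<open>x\<close> the error \<open>f - G\<close> is at most \<open>2 n\<close> times the distance to \<open>A\<close>, because both functions change
  by at most \<open>n\<close> times the distance when moving to a point of \<open>A\<close>, where they agree. The distance to
  \<open>A\<close> has Gateaux derivative zero at \<open>x\<close>, and both limits are uniform on compact sets.
\<close>

lemma hadamard_if_lipschitz_piece:
  fixes f :: "'a::real_normed_vector \<Rightarrow> real"
  assumes A: "A \<subseteq> lipschitz_points f n" "x \<in> A"
    and G: "(real n)-lipschitz_on UNIV G" "\<And>y. y \<in> A \<Longrightarrow> G y = f y"
    and L: "has_gateaux_derivative G L x"
    and M: "has_gateaux_derivative (\<lambda>y. infdist y A) M x"
  shows "hadamard_differentiable f x"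
proof -
  have M0: "blinfun_apply M h = 0" for h
  proof -
    have 1: "(quot (\<lambda>y. infdist y A) x h \<longlongrightarrow> blinfun_apply M h) (at 0)"
      using M by (simp add: has_gateaux_derivative_quot)
    then have "((\<lambda>s. infdist (x + s *\<^sub>R h) A / s) \<longlongrightarrow> 0) (at 0)"
      by (intro infdist_quot_tendsto_0 A(2)) (auto simp: differentiable_along_def)
    then have "(quot (\<lambda>y. infdist y A) x h \<longlongrightarrow> 0) (at 0)"
      using A(2) by (simp add: quot_def[abs_def])
    then show ?thesis
      using tendsto_unique[OF at_neq_bot 1] by simp
  qed
  have close: "\<bar>f y - G y\<bar> \<le> 2 * real n * r" if "infdist y A < r" "r \<le> 1 / real (Suc n)" for y r
  proof -
    obtain p where p: "p \<in> A" "dist y p < r"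
      using infdist_less_ex[OF \<open>infdist y A < r\<close>] A(2) by blast
    have "\<bar>f (p + (y - p)) - f p\<bar> \<le> real n * norm (y - p)"
    proof -
      have "norm (y - p) < 1 / real (Suc n)"
        using p(2) that(2) by (simp add: dist_norm)
      moreover have "p \<in> lipschitz_points f n"
        using p(1) A(1) by blast
      ultimately show ?thesis
        unfolding lipschitz_points_def by blast
    qed
    moreover have "\<bar>G y - G p\<bar> \<le> real n * norm (y - p)"
      by (rule lipschitz_abs_diff[OF G(1)])
    moreover have "real n * norm (y - p) \<le> real n * r"
      using p(2) by (intro mult_left_mono) (auto simp: dist_norm)
    ultimately show ?thesis
      using G(2)[OF p(1)] by simp
  qed
  have unif: "uniform_limit K (\<lambda>t h. quot f x h t) (blinfun_apply L) (at 0)" if "compact K" for K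
  proof (rule uniform_limitI)
    fix e :: real assume "e > 0"
    define \<eta> where "\<eta> = e / (4 * real (Suc n))"
    have "\<eta> > 0" "2 * real n * \<eta> \<le> e / 2"
      using \<open>e > 0\<close> by (auto simp: \<eta>_def field_simps)
    have "\<forall>\<^sub>F t in at 0. \<forall>h\<in>K. dist (quot G x h t) (blinfun_apply L h) < e / 2"
      using lipschitz_gateaux_uniform_on_compact[OF G(1) L that] \<open>e > 0\<close> by (intro uniform_limitD) auto
    moreover have "\<forall>\<^sub>F t in at 0. \<forall>h\<in>K. dist (quot (\<lambda>y. infdist y A) x h t) (blinfun_apply M h) < \<eta>"
      using lipschitz_gateaux_uniform_on_compact[OF lipschitz_infdist M that] \<open>\<eta> > 0\<close>
      by (intro uniform_limitD)
    moreover have "\<forall>\<^sub>F t in at (0::real). t \<noteq> 0 \<and> \<bar>t\<bar> < (1 / real (Suc n)) / \<eta>"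
      unfolding eventually_at using \<open>\<eta> > 0\<close>
      by (intro exI[of _ "(1 / real (Suc n)) / \<eta>"]) (auto simp: dist_real_def)
    ultimately show "\<forall>\<^sub>F t in at 0. \<forall>h\<in>K. dist (quot f x h t) (blinfun_apply L h) < e"
    proof eventually_elim
      case (elim t)
      then have t: "t \<noteq> 0" "\<bar>t\<bar> < (1 / real (Suc n)) / \<eta>"
        by simp_all
      show ?case
      proof
        fix h assume "h \<in> K"
        then have "\<bar>infdist (x + t *\<^sub>R h) A\<bar> / \<bar>t\<bar> < \<eta>"
          using elim(2) A(2) by (simp add: M0 quot_def dist_real_def abs_divide)
        then have "infdist (x + t *\<^sub>R h) A < \<eta> * \<bar>t\<bar>"
          using t(1) infdist_nonneg[of "x + t *\<^sub>R h" A] by (simp add: divide_less_eq)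
        moreover have "\<bar>t\<bar> * \<eta> < 1 / real (Suc n)"
          using t(2) \<open>\<eta> > 0\<close> by (simp only: pos_less_divide_eq)
        then have "\<eta> * \<bar>t\<bar> \<le> 1 / real (Suc n)"
          by (simp only: mult.commute less_imp_le)
        ultimately have "\<bar>f (x + t *\<^sub>R h) - G (x + t *\<^sub>R h)\<bar> \<le> 2 * real n * (\<eta> * \<bar>t\<bar>)"
          by (rule close)
        also have "\<dots> \<le> (e / 2) * \<bar>t\<bar>"
          using mult_right_mono[OF \<open>2 * real n * \<eta> \<le> e / 2\<close>, of "\<bar>t\<bar>"] by (simp add: mult.assoc)
        finally have "\<bar>f (x + t *\<^sub>R h) - G (x + t *\<^sub>R h)\<bar> / \<bar>t\<bar> \<le> e / 2"
          using t(1) by (simp add: divide_le_eq)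
        moreover have "quot f x h t - quot G x h t = (f (x + t *\<^sub>R h) - G (x + t *\<^sub>R h)) / t"
          using G(2)[OF A(2)] by (simp add: quot_def diff_divide_distrib)
        ultimately have "\<bar>quot f x h t - quot G x h t\<bar> \<le> e / 2"
          by (simp add: abs_divide)
        moreover have "\<bar>quot G x h t - blinfun_apply L h\<bar> < e / 2"
          using elim(1) \<open>h \<in> K\<close> by (simp add: dist_real_def)
        ultimately show "dist (quot f x h t) (blinfun_apply L h) < e"
          unfolding dist_real_def by linarith
      qed
    qed
  qed
  moreover have "has_gateaux_derivative f L x"
    unfolding has_gateaux_derivative_quot
  proof
    fix h
    show "(quot f x h \<longlongrightarrow> blinfun_apply L h) (at 0)"
      using tendsto_uniform_limitI[OF unif[of "{h}"]] by simp
  qed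
  ultimately show ?thesis
    unfolding hadamard_differentiable_def quot_def by blast
qed

theorem hadamard_differentiable_if_pointwise_lipschitz:
  fixes f :: "'a::{real_normed_vector, second_countable_topology} \<Rightarrow> real"
  obtains N where "aronszajn_null N"
    "\<And>x. pointwise_lipschitz f x \<Longrightarrow> x \<notin> N \<Longrightarrow> hadamard_differentiable f x"
proof -
  obtain D :: "'a set" where D: "countable D" "UNIV \<subseteq> closure D"
    by (rule separable[of "UNIV :: 'a set"])
  \<comment> \<open>Two points of such a ball are closer than the radius of validity \<open>1 / Suc n\<close>, so \<open>f\<close> is
      Lipschitz on the intersection.\<close>
  define A where "A n c = lipschitz_points f n \<inter> ball c (1 / real (Suc n) / 2)" for n and c :: 'a
  have "\<exists>G. (real n)-lipschitz_on UNIV G \<and> (\<forall>x\<in>A n c. G x = f x)" for n c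
  proof -
    have "\<bar>f x - f y\<bar> \<le> real n * dist x y" if x: "x \<in> A n c" and y: "y \<in> A n c" for x y
    proof -
      have "dist x y \<le> dist c x + dist c y"
        by (rule dist_triangle3)
      also have "\<dots> < 1 / real (Suc n) / 2 + 1 / real (Suc n) / 2"
        using x y by (intro add_strict_mono) (auto simp: A_def)
      also have "\<dots> = 1 / real (Suc n)"
        by (rule field_sum_of_halves)
      finally have "norm (x - y) < 1 / real (Suc n)"
        by (simp only: dist_norm)
      then have "\<bar>f (y + (x - y)) - f y\<bar> \<le> real n * norm (x - y)"
        using y by (simp only: A_def lipschitz_points_def Int_iff mem_Collect_eq)
      then show ?thesis
        by (simp only: dist_norm add_diff_cancel_left' add_diff_eq)
    qed
    note lip = this
    show ?thesis
      by (rule lipschitz_extension[OF of_nat_0_le_iff lip])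
  qed
  note ex = this
  define G where "G n c = (SOME G. (real n)-lipschitz_on UNIV G \<and> (\<forall>x\<in>A n c. G x = f x))" for n c
  have G: "(real n)-lipschitz_on UNIV (G n c)" "\<And>x. x \<in> A n c \<Longrightarrow> G n c x = f x" for n c
    using someI_ex[OF ex[of n c]] unfolding G_def[symmetric] by simp_all
  define E where "E g = {x. \<nexists>L. has_gateaux_derivative g L x}" for g :: "'a \<Rightarrow> real"
  define N where "N = (\<Union>n. \<Union>c\<in>D. E (G n c) \<union> E (\<lambda>y. infdist y (A n c)))"
  have "aronszajn_null (E (G n c) \<union> E (\<lambda>y. infdist y (A n c)))" for n c
    unfolding E_def
    by (intro aronszajn_null_Un lipschitz_gateaux_differentiable[OF G(1)]
        lipschitz_gateaux_differentiable[OF lipschitz_infdist])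
  then have "aronszajn_null N"
    unfolding N_def by (intro aronszajn_null_UN D(1)) simp_all
  moreover have "hadamard_differentiable f x" if "pointwise_lipschitz f x" "x \<notin> N" for x
  proof -
    from that(1) obtain n where n: "x \<in> lipschitz_points f n"
      unfolding pointwise_lipschitz_iff by (elim exE)
    have "x \<in> closure D"
      using D(2) by blast
    moreover have "0 < 1 / real (Suc n) / 2"
      by simp
    ultimately obtain c where c: "c \<in> D" "dist c x < 1 / real (Suc n) / 2"
      unfolding closure_approachable by blast
    then have "x \<in> A n c"
      using n by (simp add: A_def)
    moreover have "x \<notin> E (G n c)" "x \<notin> E (\<lambda>y. infdist y (A n c))"
      using that(2) c(1) unfolding N_def by simp_all
    then obtain L M where "has_gateaux_derivative (G n c) L x"
      "has_gateaux_derivative (\<lambda>y. infdist y (A n c)) M x"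
      unfolding E_def mem_Collect_eq not_not by (elim exE)
    moreover have "A n c \<subseteq> lipschitz_points f n"
      by (simp add: A_def)
    ultimately show ?thesis
      by (intro hadamard_if_lipschitz_piece[of "A n c" f n x "G n c" L M] G)
  qed
  ultimately show thesis
    by (rule that)
qed

section \<open>Ray-monotone functions\<close>

text \<open>Freezing the values outside \<open>[a, b]\<close> gives a monotone function on the whole line.\<close>

lemma monotone_on_pointwise_lipschitz_AE:
  fixes \<phi> :: "real \<Rightarrow> real"
  assumes "a < b" and mono: "\<And>s t. a \<le> s \<Longrightarrow> s \<le> t \<Longrightarrow> t \<le> b \<Longrightarrow> \<phi> s \<le> \<phi> t"
  shows "negligible {t. a < t \<and> t < b \<and> \<not> pointwise_lipschitz \<phi> t}"
proof -
  define \<psi> where "\<psi> t = \<phi> (max a (min b t))" for t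
  have "mono \<psi>"
    unfolding \<psi>_def using \<open>a < b\<close> by (intro monoI mono) auto
  moreover have "pointwise_lipschitz \<phi> t" if t: "a < t" "t < b" and "pointwise_lipschitz \<psi> t" for t
  proof -
    obtain C d where d: "d > 0" "\<And>h. norm h < d \<Longrightarrow> \<bar>\<psi> (t + h) - \<psi> t\<bar> \<le> C * norm h"
      using \<open>pointwise_lipschitz \<psi> t\<close> unfolding pointwise_lipschitz_def by blast
    define d' where "d' = min d (min (t - a) (b - t))"
    have eq: "\<psi> (t + h) = \<phi> (t + h)" if "norm h < d'" for h
    proof -
      have "a < t + h" "t + h < b"
        using that unfolding d'_def by auto
      then show ?thesis
        by (simp add: \<psi>_def)
    qed
    have "d' > 0"
      using d(1) t by (simp add: d'_def)
    moreover have "\<bar>\<phi> (t + h) - \<phi> t\<bar> \<le> C * norm h" if "norm h < d'" for h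
      using d(2)[of h] eq[OF that] eq[of 0] \<open>d' > 0\<close> that by (simp add: d'_def)
    ultimately show ?thesis
      unfolding pointwise_lipschitz_def by blast
  qed
  ultimately show ?thesis
    by (intro negligible_subset[OF monotone_pointwise_lipschitz_AE[of \<psi>]]) auto
qed

text \<open>
  If \<open>norm h\<close> is small compared with \<open>s\<close>, then the ray from a point near \<open>y - v\<close> through \<open>y + h\<close> passes
  through \<open>y + s v\<close>, and the ray from another such point through \<open>y - s v\<close> passes through \<open>y + h\<close>. Monotonicity on
  these rays bounds \<open>g (y + h)\<close> by values on the line through \<open>y\<close> in direction \<open>v\<close>; take \<open>s\<close> proportional to
  \<open>norm h\<close>.
\<close>

lemma ray_monotone_pointwise_lipschitz_on_line:
  fixes g :: "'a::real_normed_vector \<Rightarrow> real"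
  assumes "r > 0"
    and ray: "\<And>w y t. w \<in> ball z r \<Longrightarrow> t \<ge> 0 \<Longrightarrow> g y \<le> g (y + t *\<^sub>R (y - w))"
    and v: "dist (y - v) z < 3 * r / 4"
    and lip: "pointwise_lipschitz (\<lambda>t. g (y + t *\<^sub>R v)) 0"
  shows "pointwise_lipschitz g y"
proof -
  obtain C d where d: "d > 0" and C: "\<And>s. norm s < d \<Longrightarrow> \<bar>g (y + s *\<^sub>R v) - g y\<bar> \<le> C * norm s"
    using lip unfolding pointwise_lipschitz_def by auto
  define w where "w = y - v"
  have near: "w + k \<in> ball z r" if "norm k < r / 4" for k
  proof -
    have "dist (w + k) z \<le> norm k + dist w z"
      using norm_triangle_ineq[of k "w - z"] by (simp add: dist_norm algebra_simps)
    also have "\<dots> < r"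
      using that v by (simp add: w_def)
    finally show ?thesis
      by (simp add: dist_commute)
  qed
  have up: "g (y + h) \<le> g (y + s *\<^sub>R v)" if s: "0 < s" "s \<le> 1 / 2" and h: "norm h < s * r / 8" for s h
  proof -
    \<comment> \<open>The shift of the starting point that makes the ray hit \<open>y + s v\<close> at parameter \<open>s\<close>.\<close>
    define k where "k = ((1 + s) / s) *\<^sub>R h"
    have "norm k = (1 + s) * (norm h / s)"
      using s by (simp add: k_def)
    also have "\<dots> < (1 + s) * (r / 8)"
      using s h by (intro mult_strict_left_mono) (auto simp: field_simps)
    also have "\<dots> \<le> 2 * (r / 8)"
      using s \<open>r > 0\<close> by (intro mult_right_mono) auto
    finally have "w + k \<in> ball z r"
      by (intro near) simp
    then have "g (y + h) \<le> g ((y + h) + s *\<^sub>R ((y + h) - (w + k)))"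
      by (rule ray) (use s in simp)
    moreover have "s *\<^sub>R k = h + s *\<^sub>R h"
      using s by (simp add: k_def scaleR_left_distrib)
    then have "(y + h) + s *\<^sub>R ((y + h) - (w + k)) = y + s *\<^sub>R v"
      by (simp add: w_def algebra_simps)
    ultimately show ?thesis
      by (simp only:)
  qed
  have down: "g (y + (- s) *\<^sub>R v) \<le> g (y + h)" if s: "0 < s" "s \<le> 1 / 2" and h: "norm h < s * r / 8" for s h
  proof -
    \<comment> \<open>The ray from \<open>w\<close> through \<open>y - s v\<close> reaches \<open>y\<close> at parameter \<open>t\<close>; the shift \<open>k\<close> turns this into \<open>y + h\<close>.\<close>
    define t where "t = s / (1 - s)"
    have t: "t > 0" "t * (1 - s) = s"
      using s by (auto simp: t_def)
    define k where "k = - ((1 / t) *\<^sub>R h)"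
    have "s \<le> t"
      using s mult_left_mono[of "1 - s" 1 t] t by simp
    have "norm k = norm h / t"
      using t by (simp add: k_def)
    also have "\<dots> \<le> norm h / s"
      using s \<open>s \<le> t\<close> by (intro divide_left_mono) auto
    also have "\<dots> < r / 4"
    proof -
      have "s * r > 0"
        using s \<open>r > 0\<close> by simp
      then have "norm h < r / 4 * s"
        using h by (simp add: mult.commute)
      then show ?thesis
        using s by (simp add: pos_divide_less_eq)
    qed
    finally have "w + k \<in> ball z r"
      by (rule near)
    then have "g (y + (- s) *\<^sub>R v) \<le> g ((y + (- s) *\<^sub>R v) + t *\<^sub>R ((y + (- s) *\<^sub>R v) - (w + k)))"
      by (rule ray) (use t in simp)
    also have "t *\<^sub>R ((y + (- s) *\<^sub>R v) - (w + k)) = (t * (1 - s)) *\<^sub>R v - t *\<^sub>R k"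
      by (simp add: w_def algebra_simps)
    also have "\<dots> = s *\<^sub>R v + h"
      using t by (simp add: k_def)
    finally show ?thesis
      by simp
  qed
  define e where "e = min (r / 32) (d * r / 16)"
  have "e > 0"
    using \<open>r > 0\<close> d by (simp add: e_def)
  moreover have "\<bar>g (y + h) - g y\<bar> \<le> (C * (16 / r)) * norm h" if "norm h < e" for h
  proof (cases "h = 0")
    case False
    define s where "s = 16 / r * norm h"
    have s: "0 < s" "s \<le> 1 / 2" "norm h < s * r / 8" "s < d"
      using that False \<open>r > 0\<close> by (auto simp: s_def e_def field_simps)
    have "g (y + h) \<le> g (y + s *\<^sub>R v)" "g (y + (- s) *\<^sub>R v) \<le> g (y + h)"
      using up[OF s(1-3)] down[OF s(1-3)] by simp_all
    moreover have "\<bar>g (y + s *\<^sub>R v) - g y\<bar> \<le> C * s" "\<bar>g (y + (- s) *\<^sub>R v) - g y\<bar> \<le> C * s"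
      using C[of s] C[of "- s"] s by simp_all
    ultimately have "\<bar>g (y + h) - g y\<bar> \<le> C * s"
      by linarith
    then show ?thesis
      by (simp add: s_def mult.assoc)
  qed simp
  ultimately show ?thesis
    unfolding pointwise_lipschitz_def by blast
qed

text \<open>
  Near a point \<open>c\<close> every direction \<open>v\<close> close to \<open>c - z\<close> works, because \<open>y - v\<close> then stays well
  inside the ball around \<open>z\<close>. These directions form an open set, which meets the span of every
  sequence with dense span. Countably many \<open>c\<close> cover the space.
\<close>

lemma ray_monotone_pointwise_lipschitz:
  fixes g :: "'a::{real_normed_vector, second_countable_topology} \<Rightarrow> real"
  assumes "r > 0"
    and ray: "\<And>w y t. w \<in> ball z r \<Longrightarrow> t \<ge> 0 \<Longrightarrow> g y \<le> g (y + t *\<^sub>R (y - w))"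
  shows "aronszajn_null {x. \<not> pointwise_lipschitz g x}"
proof -
  define E where "E = {x. \<not> pointwise_lipschitz g x}"
  have E: "E \<in> sets borel"
  proof -
    have "E = - {x. pointwise_lipschitz g x}"
      unfolding E_def by (rule Collect_neg_eq)
    then show ?thesis
      by (simp only: borel_comp[OF pointwise_lipschitz_borel])
  qed
  have local: "aronszajn_null (E \<inter> ball c (r / 4))" (is "aronszajn_null ?F") for c
    unfolding aronszajn_null_iff
  proof (intro conjI allI impI)
    show F: "?F \<in> sets borel"
      by (intro sets.Int E borel_open open_ball)
    fix \<xi> :: "nat \<Rightarrow> 'a" assume "closure (span (range \<xi>)) = UNIV"
    then have "c - z \<in> closure (span (range \<xi>))"
      by (simp only: UNIV_I)
    moreover have "r / 2 > 0"
      using \<open>r > 0\<close> by simp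
    ultimately obtain v where v: "v \<in> span (range \<xi>)" "dist v (c - z) < r / 2"
      unfolding closure_approachable by (elim allE[of _ "r / 2"]) auto
    have near: "dist (y - v) z < 3 * r / 4" if "y \<in> ball c (r / 4)" for y
    proof -
      have "dist (y - v) z \<le> dist y c + dist (c - z) v"
      proof -
        have eq: "(y - v) - z = (y - c) + ((c - z) - v)"
          by (simp add: algebra_simps)
        show ?thesis
          unfolding dist_norm eq by (rule norm_triangle_ineq)
      qed
      also have "\<dots> < r / 4 + r / 2"
        using that v(2) by (intro add_strict_mono) (simp_all add: dist_commute)
      finally show ?thesis
        by simp
    qed
    have "line_null v ?F"
    proof (rule line_nullI[OF F])
      fix x
      define \<phi> where "\<phi> t = g (x + t *\<^sub>R v)" for t
      define J where "J = {t. x + t *\<^sub>R v \<in> ball c (r / 4)}"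
      have mono: "\<phi> s \<le> \<phi> t" if "s \<in> J" "s \<le> t" for s t
      proof -
        have "(x + s *\<^sub>R v) - v \<in> ball z r"
        proof -
          have "dist ((x + s *\<^sub>R v) - v) z < 3 * r / 4"
            using that(1) by (intro near) (simp only: J_def mem_Collect_eq)
          also have "\<dots> \<le> r"
            using \<open>r > 0\<close> by simp
          finally show ?thesis
            by (simp only: mem_ball dist_commute)
        qed
        then have "g (x + s *\<^sub>R v) \<le> g ((x + s *\<^sub>R v) + (t - s) *\<^sub>R ((x + s *\<^sub>R v) - ((x + s *\<^sub>R v) - v)))"
          by (rule ray) (use that(2) in simp)
        moreover have "(x + s *\<^sub>R v) + (t - s) *\<^sub>R ((x + s *\<^sub>R v) - ((x + s *\<^sub>R v) - v)) = x + t *\<^sub>R v"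
          by (simp add: scaleR_left_diff_distrib)
        ultimately show ?thesis
          by (simp only: \<phi>_def)
      qed
      have "open J"
      proof -
        have "open ((\<lambda>t. x + t *\<^sub>R v) -` ball c (r / 4))"
          by (rule open_vimage[OF open_ball]) (intro continuous_intros)
        then show ?thesis
          by (simp only: J_def vimage_def)
      qed
      have conv: "s \<in> J" if "a \<in> J" "b \<in> J" "a \<le> s" "s \<le> b" for a b s
      proof -
        have "convex J"
        proof (rule convexI)
          fix s t u w :: real
          assume st: "s \<in> J" "t \<in> J" and uw: "0 \<le> u" "0 \<le> w" "u + w = 1"
          have "x + (u * s + w * t) *\<^sub>R v =
              (u + w) *\<^sub>R x + (u * s + w * t) *\<^sub>R v"
            using uw(3) by simp
          also have "\<dots> = u *\<^sub>R (x + s *\<^sub>R v) + w *\<^sub>R (x + t *\<^sub>R v)"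
            by (simp add: scaleR_left_distrib scaleR_right_distrib)
          also have "\<dots> \<in> ball c (r / 4)"
            using st uw unfolding J_def by (intro convexD[OF convex_ball]) simp_all
          finally show "u *\<^sub>R s + w *\<^sub>R t \<in> J"
            by (simp add: J_def)
        qed
        then have "is_interval J"
          by (simp only: is_interval_convex_1)
        then show ?thesis
          using that by (rule mem_is_interval_1_I)
      qed
      have neg: "negligible {t. a < t \<and> t < b \<and> \<not> pointwise_lipschitz \<phi> t}"
        if "a \<in> J" "b \<in> J" "a < b" for a b
      proof (rule monotone_on_pointwise_lipschitz_AE[OF \<open>a < b\<close>])
        fix s t assume "a \<le> s" "s \<le> t" "t \<le> b"
        then have "s \<in> J"
          using conv[OF that(1,2), of s] by linarith
        then show "\<phi> s \<le> \<phi> t"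
          using \<open>s \<le> t\<close> by (rule mono)
      qed
      define I where "I = {(a, b). a \<in> \<rat> \<inter> J \<and> b \<in> \<rat> \<inter> J \<and> a < b}"
      have "countable I"
        by (rule countable_subset[of _ "\<rat> \<times> \<rat>"]) (auto simp: I_def intro!: countable_SIGMA countable_rat)
      have "negligible (\<Union>i\<in>I. {t. fst i < t \<and> t < snd i \<and> \<not> pointwise_lipschitz \<phi> t})"
      proof (intro negligible_countable_Union countable_image \<open>countable I\<close>)
        fix T assume "T \<in> (\<lambda>i. {t. fst i < t \<and> t < snd i \<and> \<not> pointwise_lipschitz \<phi> t}) ` I"
        then obtain i where "i \<in> I"
          and T: "T = {t. fst i < t \<and> t < snd i \<and> \<not> pointwise_lipschitz \<phi> t}"
          by (elim imageE) simp
        then have "fst i \<in> J" "snd i \<in> J" "fst i < snd i"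
          unfolding I_def by auto
        then show "negligible T"
          unfolding T by (rule neg)
      qed
      moreover have "{t. x + t *\<^sub>R v \<in> ?F} \<subseteq>
          (\<Union>i\<in>I. {t. fst i < t \<and> t < snd i \<and> \<not> pointwise_lipschitz \<phi> t})"
      proof
        fix t assume "t \<in> {t. x + t *\<^sub>R v \<in> ?F}"
        then have t: "t \<in> J" "\<not> pointwise_lipschitz g (x + t *\<^sub>R v)"
          by (auto simp: J_def E_def)
        obtain e where e: "e > 0" "ball t e \<subseteq> J"
          using \<open>open J\<close> t(1) open_contains_ball by blast
        obtain a where a: "a \<in> \<rat>" "t - e < a" "a < t"
          using Rats_dense_in_real[of "t - e" t] e(1) by auto
        obtain b where b: "b \<in> \<rat>" "t < b" "b < t + e"
          using Rats_dense_in_real[of t "t + e"] e(1) by auto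
        have "a \<in> ball t e" "b \<in> ball t e"
          using a b by (auto simp: dist_real_def)
        then have "(a, b) \<in> I"
          using a b e(2) by (auto simp: I_def)
        moreover have "\<not> pointwise_lipschitz \<phi> t"
        proof
          assume "pointwise_lipschitz \<phi> t"
          then have "pointwise_lipschitz (\<lambda>s. g ((x + t *\<^sub>R v) + s *\<^sub>R v)) 0"
            by (simp add: pointwise_lipschitz_def \<phi>_def scaleR_left_distrib add.assoc)
          moreover have "dist ((x + t *\<^sub>R v) - v) z < 3 * r / 4"
            using t(1) by (intro near) (simp only: J_def mem_Collect_eq)
          ultimately have "pointwise_lipschitz g (x + t *\<^sub>R v)"
            by (intro ray_monotone_pointwise_lipschitz_on_line[OF \<open>r > 0\<close> ray])
          then show False
            using t(2) by simp
        qed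
        ultimately show "t \<in> (\<Union>i\<in>I. {t. fst i < t \<and> t < snd i \<and> \<not> pointwise_lipschitz \<phi> t})"
          using a(3) b(2) by (intro UN_I[of "(a, b)"]) simp_all
      qed
      ultimately show "negligible {t. x + t *\<^sub>R v \<in> ?F}"
        by (rule negligible_subset)
    qed
    then show "decomposable_along \<xi> ?F"
      by (rule decomposable_along_if_line_null[OF F v(1)])
  qed
  obtain D :: "'a set" where D: "countable D" "UNIV \<subseteq> closure D"
    by (rule separable[of "UNIV :: 'a set"])
  have "aronszajn_null (\<Union>c\<in>D. E \<inter> ball c (r / 4))"
    by (intro aronszajn_null_UN D(1) local)
  moreover have "(\<Union>c\<in>D. E \<inter> ball c (r / 4)) = E"
  proof -
    have "\<exists>c\<in>D. dist c x < r / 4" for x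
    proof -
      have "x \<in> closure D" "r / 4 > 0"
        using D(2) \<open>r > 0\<close> by auto
      then show ?thesis
        unfolding closure_approachable by blast
    qed
    then have "(\<Union>c\<in>D. ball c (r / 4)) = UNIV"
      by (simp add: set_eq_iff)
    then show ?thesis
      by (simp only: Int_UN_distrib[symmetric] Int_UNIV_right)
  qed
  ultimately show ?thesis
    by (simp add: E_def)
qed

section \<open>Frontiers of convex sets\<close>

text \<open>
  The distance vanishes at \<open>x\<close>, so its derivative would be zero. But walking from \<open>x\<close> straight away
  from \<open>z\<close>, the distance grows at rate at least \<open>r\<close>: the convex hull of a closer point \<open>w\<close> of \<open>C\<close> and
  the ball around \<open>z\<close> lies in \<open>C\<close> and would have \<open>x\<close> in its interior.
\<close>

lemma convex_frontier_infdist_not_gateaux: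
  fixes C :: "'a::real_normed_vector set"
  assumes "convex C" and ball: "ball z r \<subseteq> C" "r > 0" and x: "x \<in> frontier C"
  shows "\<nexists>L. has_gateaux_derivative (\<lambda>y. infdist y (closure C)) L x"
proof
  assume "\<exists>L. has_gateaux_derivative (\<lambda>y. infdist y (closure C)) L x"
  then obtain L where L: "has_gateaux_derivative (\<lambda>y. infdist y (closure C)) L x" ..
  have "x \<in> closure C" "x \<notin> interior C"
    using x unfolding frontier_def by simp_all
  have "differentiable_along (\<lambda>y. infdist y (closure C)) (x - z) x"
    unfolding differentiable_along_def
  proof
    show "(quot (\<lambda>y. infdist y (closure C)) x (x - z) \<longlongrightarrow> blinfun_apply L (x - z)) (at 0)"
      using L unfolding has_gateaux_derivative_quot ..
  qed
  then have "((\<lambda>s. infdist (x + s *\<^sub>R (x - z)) (closure C) / s) \<longlongrightarrow> 0) (at 0)"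
    by (rule infdist_quot_tendsto_0[OF \<open>x \<in> closure C\<close>])
  then have "\<forall>\<^sub>F s in at 0. dist (infdist (x + s *\<^sub>R (x - z)) (closure C) / s) 0 < r"
    using \<open>r > 0\<close> by (rule tendstoD)
  then obtain d where d: "d > 0" "\<forall>s\<in>UNIV. s \<noteq> 0 \<and> dist s 0 < d \<longrightarrow>
      dist (infdist (x + s *\<^sub>R (x - z)) (closure C) / s) 0 < r"
    unfolding eventually_at by (elim exE conjE)
  define s where "s = d / 2"
  define y where "y = x + s *\<^sub>R (x - z)"
  have s: "s > 0"
    using d(1) by (simp add: s_def)
  have "infdist y (closure C) / s < r"
  proof -
    have "dist s 0 < d"
      using d(1) by (simp add: s_def)
    then have "dist (infdist y (closure C) / s) 0 < r"
      using bspec[OF d(2), of s] s unfolding y_def by simp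
    then show ?thesis
      unfolding dist_real_def diff_0_right by linarith
  qed
  then have "infdist y (closure C) < s * r"
    using s by (simp add: divide_less_eq mult.commute)
  then obtain w0 where w0: "w0 \<in> closure C" "dist y w0 < s * r"
  proof (rule infdist_less_ex)
    show "closure C \<noteq> {}"
      using \<open>x \<in> closure C\<close> by (rule_tac notI) simp
  qed
  have "s * r - dist y w0 > 0"
    using w0(2) by simp
  then obtain w where w: "w \<in> C" "dist w w0 < s * r - dist y w0"
    using iffD1[OF closure_approachable w0(1)] by (elim allE[of _ "s * r - dist y w0"]) auto
  have yw: "norm (y - w) < s * r"
    using w(2) dist_triangle[of y w w0] unfolding dist_norm[of y w, symmetric] dist_commute[of w0 w]
    by linarith
  \<comment> \<open>Chosen such that each \<open>p\<close> in this ball divides the segment from \<open>w\<close> to some point \<open>z + k\<close> of the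
      ball around \<open>z\<close> in the ratio \<open>s : 1\<close>.\<close>
  define \<rho> where "\<rho> = (r - norm (y - w) / s) * (s / (1 + s))"
  have "\<rho> > 0"
  proof -
    have "norm (y - w) / s < r"
      using yw s by (simp only: pos_divide_less_eq mult.commute)
    then have "r - norm (y - w) / s > 0"
      by (simp only: diff_gt_0_iff_gt)
    moreover have "s / (1 + s) > 0"
      using s by simp
    ultimately show ?thesis
      unfolding \<rho>_def by (rule mult_pos_pos)
  qed
  have "ball x \<rho> \<subseteq> C"
  proof
    fix p assume "p \<in> ball x \<rho>"
    then have p: "norm (p - x) < \<rho>"
      by (simp add: dist_norm norm_minus_commute)
    define k where "k = (1 / s) *\<^sub>R (y - w) + ((1 + s) / s) *\<^sub>R (p - x)"
    have "norm k \<le> norm (y - w) / s + (1 + s) / s * norm (p - x)"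
      unfolding k_def using s by (intro order_trans[OF norm_triangle_ineq]) simp
    also have "\<dots> < norm (y - w) / s + (1 + s) / s * \<rho>"
      using p s by (intro add_strict_left_mono mult_strict_left_mono) auto
    also have "(1 + s) / s * \<rho> = r - norm (y - w) / s"
      using s by (simp add: \<rho>_def)
    finally have "norm k < r"
      by simp
    then have "z + k \<in> C"
      by (intro subsetD[OF ball(1)]) (simp add: dist_norm)
    have "s *\<^sub>R k = (y - w) + (1 + s) *\<^sub>R (p - x)"
      using s by (simp add: k_def scaleR_right_distrib)
    then have "w + s *\<^sub>R (z + k) = w + s *\<^sub>R z + ((y - w) + (1 + s) *\<^sub>R (p - x))"
      by (simp only: scaleR_right_distrib add.assoc)
    also have "\<dots> = (1 + s) *\<^sub>R p"
      unfolding y_def by (simp add: algebra_simps)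
    finally have "(1 / (1 + s)) *\<^sub>R (w + s *\<^sub>R (z + k)) = (1 / (1 + s)) *\<^sub>R ((1 + s) *\<^sub>R p)"
      by (simp only:)
    also have "\<dots> = p"
      using s by simp
    also have "(1 / (1 + s)) *\<^sub>R (w + s *\<^sub>R (z + k)) =
        (1 / (1 + s)) *\<^sub>R w + (s / (1 + s)) *\<^sub>R (z + k)"
      by (simp only: scaleR_right_distrib scaleR_scaleR) simp
    finally have "(1 / (1 + s)) *\<^sub>R w + (s / (1 + s)) *\<^sub>R (z + k) = p" .
    moreover have "1 / (1 + s) + s / (1 + s) = 1"
      using s by (simp add: add_divide_distrib[symmetric])
    moreover have "0 \<le> 1 / (1 + s)" "0 \<le> s / (1 + s)"
      using s by simp_all
    ultimately show "p \<in> C"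
      using convexD[OF \<open>convex C\<close> w(1) \<open>z + k \<in> C\<close>, of "1 / (1 + s)" "s / (1 + s)"] by (simp only:)
  qed
  then have "x \<in> interior C"
    using \<open>\<rho> > 0\<close> by (auto simp: mem_interior)
  then show False
    using \<open>x \<notin> interior C\<close> by simp
qed

lemma aronszajn_null_convex_frontier:
  fixes C :: "'a::{real_normed_vector, second_countable_topology} set"
  assumes "convex C" "interior C \<noteq> {}"
  shows "aronszajn_null (frontier C)"
proof -
  obtain z r where "r > 0" "ball z r \<subseteq> C"
    using assms(2) by (auto simp: mem_interior)
  then have "frontier C \<subseteq> {x. \<nexists>L. has_gateaux_derivative (\<lambda>y. infdist y (closure C)) L x}"
    using convex_frontier_infdist_not_gateaux[OF \<open>convex C\<close>] by blast
  then show ?thesis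
    by (intro aronszajn_null_subset[OF lipschitz_gateaux_differentiable[OF lipschitz_infdist]]
        borel_closed frontier_closed)
qed

section \<open>Quasiconvex functions\<close>

text \<open>The point \<open>y\<close> lies between \<open>w\<close> and \<open>y + t (y - w)\<close>, and the value at \<open>w\<close> does not exceed \<open>q\<close>.\<close>

lemma quasiconvex_max_ray_monotone:
  fixes f :: "'a::real_vector \<Rightarrow> real"
  assumes "quasiconvex f" "f w < q" "t \<ge> 0"
  shows "max (f y) q \<le> max (f (y + t *\<^sub>R (y - w))) q"
proof -
  define l where "l = 1 / (1 + t)"
  have l: "l \<in> {0..1}" "1 - l = t / (1 + t)"
    using assms(3) by (auto simp: l_def field_simps)
  have y: "l *\<^sub>R (y + t *\<^sub>R (y - w)) + (1 - l) *\<^sub>R w = y"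
  proof -
    have eq: "(1 + t) *\<^sub>R y = (y + t *\<^sub>R (y - w)) + t *\<^sub>R w"
      by (simp add: algebra_simps)
    have "(1 / (1 + t)) *\<^sub>R ((1 + t) *\<^sub>R y) = y"
      using assms(3) by simp
    then have "(1 / (1 + t)) *\<^sub>R ((y + t *\<^sub>R (y - w)) + t *\<^sub>R w) = y"
      unfolding eq .
    moreover have "(t / (1 + t)) *\<^sub>R w = (1 / (1 + t)) *\<^sub>R (t *\<^sub>R w)"
      by simp
    ultimately show ?thesis
      unfolding l(2) unfolding l_def by (simp only: scaleR_right_distrib[symmetric])
  qed
  have "f (l *\<^sub>R (y + t *\<^sub>R (y - w)) + (1 - l) *\<^sub>R w) \<le> max (f (y + t *\<^sub>R (y - w))) (f w)"
    using assms(1) l(1) unfolding quasiconvex_def by blast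
  then have "f y \<le> max (f (y + t *\<^sub>R (y - w))) (f w)"
    by (simp only: y)
  then show ?thesis
    using assms(2) by auto
qed

lemma quasiconvex_convex_sublevel:
  assumes "quasiconvex f"
  shows "convex {x. f x < q}"
  unfolding convex_def
proof (intro ballI allI impI)
  fix x y and u v :: real
  assume xy: "x \<in> {x. f x < q}" "y \<in> {x. f x < q}" and uv: "0 \<le> u" "0 \<le> v" "u + v = 1"
  then have "v = 1 - u" "u \<in> {0..1}"
    by auto
  then have "f (u *\<^sub>R x + v *\<^sub>R y) \<le> max (f x) (f y)"
    using assms unfolding quasiconvex_def by blast
  then show "u *\<^sub>R x + v *\<^sub>R y \<in> {x. f x < q}"
    using xy by auto
qed

lemma nowhere_dense_imp_first_category: "nowhere_dense S \<Longrightarrow> first_category S"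
  unfolding first_category_def by (intro exI[of _ "\<lambda>_. S"]) simp

text \<open>
  A level below \<open>q\<close> already has a sublevel set of second category, hence one that is dense in some
  open set. A continuity point in there has value at most that level, so \<open>f < q\<close> around it.
\<close>

lemma sublevel_interior_above_ess_inf:
  fixes f :: "'a::metric_space \<Rightarrow> real"
  assumes "densely_continuous f" "top_ess_inf f < ereal q"
  shows "interior {x. f x < q} \<noteq> {}"
proof -
  obtain \<alpha> where \<alpha>: "top_ess_inf f < ereal \<alpha>" "\<alpha> < q"
    using ereal_dense2[OF assms(2)] by auto
  define F where "F = strict_sublevel f (ereal \<alpha>)"
  have "\<not> first_category F"
  proof
    assume "first_category F"
    then have "ereal \<alpha> \<le> top_ess_inf f"
      unfolding top_ess_inf_def F_def by (intro Sup_upper) blast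
    then show False
      using \<alpha>(1) by simp
  qed
  then have "interior (closure F) \<noteq> {}"
    using nowhere_dense_imp_first_category unfolding nowhere_dense_def by blast
  then obtain D where D: "closure D = UNIV" "\<And>x. x \<in> D \<Longrightarrow> isCont f x"
    using assms(1) unfolding densely_continuous_def by blast
  have "interior (closure F) \<inter> D \<noteq> {}"
    using open_Int_closure_eq_empty[OF open_interior, of "closure F" D] D(1)
      \<open>interior (closure F) \<noteq> {}\<close> by auto
  then obtain c where c: "c \<in> closure F" "isCont f c"
    using D(2) interior_subset by blast
  have "f c \<le> \<alpha>"
  proof (rule ccontr)
    assume "\<not> f c \<le> \<alpha>"
    then have "\<forall>\<^sub>F x in nhds c. \<alpha> < f x"
      using c(2) by (intro order_tendstoD(1)[of f "f c"]) (auto simp: isCont_def tendsto_at_iff_tendsto_nhds)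
    then obtain S where S: "open S" "c \<in> S" "\<And>x. x \<in> S \<Longrightarrow> \<alpha> < f x"
      unfolding eventually_nhds by blast
    have "S \<inter> F \<noteq> {}"
      using c(1) S(1,2) open_Int_closure_eq_empty by blast
    then show False
      using S(3) by (force simp: F_def strict_sublevel_def)
  qed
  then have "\<forall>\<^sub>F x in nhds c. f x < q"
    using c(2) \<alpha>(2)
    by (intro order_tendstoD(2)[of f "f c"]) (auto simp: isCont_def tendsto_at_iff_tendsto_nhds)
  then obtain S where "open S" "c \<in> S" "\<And>x. x \<in> S \<Longrightarrow> f x < q"
    unfolding eventually_nhds by blast
  then have "c \<in> interior {x. f x < q}"
    by (intro interiorI[of S]) auto
  then show ?thesis
    by blast
qed

theorem theorem4p2:
  fixes f :: "'a::separable_banach \<Rightarrow> real"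
  assumes "quasiconvex f"
    and "densely_continuous f"
  shows "\<exists>N. aronszajn_null N \<and>
    (\<forall>x \<in> (UNIV - sublevel f (top_ess_inf f)) - N. hadamard_differentiable f x)"
proof -
  define F where "F q = {x. f x < q}" for q
  define g where "g q x = max (f x) q" for q x
  define Q where "Q = {q \<in> \<rat>. interior (F q) \<noteq> {}}"
  have "countable Q"
    by (rule countable_subset[of _ "\<rat>"]) (auto simp: Q_def countable_rat)
  obtain N0 where N0: "aronszajn_null N0"
    "\<And>x. pointwise_lipschitz f x \<Longrightarrow> x \<notin> N0 \<Longrightarrow> hadamard_differentiable f x"
    using hadamard_differentiable_if_pointwise_lipschitz[of f] by blast
  define B where "B q = frontier (F q) \<union> {x. \<not> pointwise_lipschitz (g q) x}" for q
  have "aronszajn_null (B q)" if "q \<in> Q" for q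
    unfolding B_def
  proof (rule aronszajn_null_Un)
    have int: "interior (F q) \<noteq> {}"
      using that by (simp add: Q_def)
    then show "aronszajn_null (frontier (F q))"
      unfolding F_def by (intro aronszajn_null_convex_frontier quasiconvex_convex_sublevel assms(1))
    obtain z r where zr: "r > 0" "ball z r \<subseteq> F q"
      using int by (auto simp: mem_interior)
    show "aronszajn_null {x. \<not> pointwise_lipschitz (g q) x}"
    proof (rule ray_monotone_pointwise_lipschitz[OF zr(1)])
      fix w y :: 'a and t :: real assume "w \<in> ball z r" "t \<ge> 0"
      then have "f w < q"
        using zr(2) by (auto simp: F_def)
      then show "g q y \<le> g q (y + t *\<^sub>R (y - w))"
        unfolding g_def by (rule quasiconvex_max_ray_monotone[OF assms(1) _ \<open>t \<ge> 0\<close>])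
    qed
  qed
  then have "aronszajn_null (N0 \<union> (\<Union>q\<in>Q. B q))"
    by (intro aronszajn_null_Un N0(1) aronszajn_null_UN \<open>countable Q\<close>)
  moreover have "hadamard_differentiable f x"
    if x: "x \<notin> sublevel f (top_ess_inf f)" "x \<notin> N0 \<union> (\<Union>q\<in>Q. B q)" for x
  proof (rule N0(2))
    show "x \<notin> N0"
      using x(2) by simp
    have "top_ess_inf f < ereal (f x)"
      using x(1) by (simp add: sublevel_def)
    then obtain r where r: "top_ess_inf f < ereal (of_rat r)" "ereal (of_rat r) < ereal (f x)"
      using ereal_dense3 by blast
    define q :: real where "q = of_rat r"
    have q: "top_ess_inf f < ereal q" "q < f x"
      using r by (simp_all add: q_def)
    have "q \<in> Q"
      using sublevel_interior_above_ess_inf[OF assms(2) q(1)] by (simp add: Q_def F_def q_def)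
    then have "x \<notin> frontier (F q)" and lip: "pointwise_lipschitz (g q) x"
      using x(2) by (auto simp: B_def)
    then have "x \<notin> closure (F q)"
      using q(2) interior_subset[of "F q"] by (auto simp: frontier_def F_def)
    then obtain e where e: "e > 0" "ball x e \<subseteq> - closure (F q)"
      using open_contains_ball[of "- closure (F q)"] by auto
    have eq: "g q (x + h) = f (x + h)" if "norm h < e" for h
    proof -
      have "x + h \<in> ball x e"
        using that by (simp add: dist_norm)
      then have "x + h \<notin> F q"
        using e(2) closure_subset by blast
      then show ?thesis
        by (simp add: g_def F_def)
    qed
    obtain C d where d: "d > 0" "\<And>h. norm h < d \<Longrightarrow> \<bar>g q (x + h) - g q x\<bar> \<le> C * norm h"
      using lip unfolding pointwise_lipschitz_def by blast
    have "\<bar>f (x + h) - f x\<bar> \<le> C * norm h" if "norm h < min d e" for h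
      using d(2)[of h] eq[of h] eq[of 0] e(1) that by simp
    then show "pointwise_lipschitz f x"
      unfolding pointwise_lipschitz_def using d(1) e(1)
      by (intro exI[of _ C] exI[of _ "min d e"]) simp
  qed
  ultimately show ?thesis
    by (intro exI[of _ "N0 \<union> (\<Union>q\<in>Q. B q)"]) simp
qed

end
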